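(* Let $f,g\colon X\to Y$ be maps and let $R$ be a commutative ring. If there exist cohomology classes $u_0,u_1,\dots,u_k\in\mathcal J(f,g;R)$ with $u_0\smile u_1\smile\cdots\smile u_k\neq0$, then $$\mathrm{H^*D}_m(f,g;R)\ge k+1,$$ where $m=\max\{\deg(u_i)\mid i=0,1,\dots,k\}$.
   Context: Cohomology classes are homogeneous, and $\deg(u)$ is the degree of $u$. $\mathcal J(f,g;R)\subseteq H^*(X;R)$ denotes the image of the linear homomorphism $f^*-g^*\colon H^*(Y;R)\to H^*(X;R)$. For an integer $m\ge0$, the $m$-cohomological distance $\mathrm{H^*D}_m(f,g;R)$ is the least integer $k$ such that $X$ admits an open cover $\{U_i\}_{i=0}^k$ such that, for each $i$, every $m$-dimensional CW complex $P$ and every map $\phi\colon P\to U_i$, one has $\phi^*\circ(f|_{U_i})^*=\phi^*\circ(g|_{U_i})^*\colon H^*(Y;R)\to H^*(P;R)$. *)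

theory Defs
  imports "HOL-Homology.Homology" "HOL-Library.Extended_Nat"
begin

section \<open>Singular cohomology with coefficients in a commutative ring\<close>

text \<open>
  A p-cochain is a function on the singular p-simplices of X; it is set to 0 on everything
  else, so that equality of cochains is equality of functions.
\<close>

definition cochains :: "nat \<Rightarrow> 'a topology \<Rightarrow> (((nat \<Rightarrow> real) \<Rightarrow> 'a) \<Rightarrow> 'r::comm_ring_1) set"
  where "cochains p X = {c. \<forall>s. \<not> singular_simplex p X s \<longrightarrow> c s = 0}"

definition coboundary ::
    "nat \<Rightarrow> 'a topology \<Rightarrow> (((nat \<Rightarrow> real) \<Rightarrow> 'a) \<Rightarrow> 'r::comm_ring_1) \<Rightarrow> ((nat \<Rightarrow> real) \<Rightarrow> 'a) \<Rightarrow> 'r"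
  where "coboundary p X c =
    (\<lambda>s. if singular_simplex (Suc p) X s
         then \<Sum>k\<le>Suc p. (-1) ^ k * c (singular_face (Suc p) k s) else 0)"

definition cocycles :: "nat \<Rightarrow> 'a topology \<Rightarrow> (((nat \<Rightarrow> real) \<Rightarrow> 'a) \<Rightarrow> 'r::comm_ring_1) set"
  where "cocycles p X = {c \<in> cochains p X. coboundary p X c = (\<lambda>s. 0)}"

definition coboundaries :: "nat \<Rightarrow> 'a topology \<Rightarrow> (((nat \<Rightarrow> real) \<Rightarrow> 'a) \<Rightarrow> 'r::comm_ring_1) set"
  where "coboundaries p X =
    (case p of 0 \<Rightarrow> {\<lambda>s. 0} | Suc q \<Rightarrow> coboundary q X ` cochains q X)"

definition cohomologous ::
    "nat \<Rightarrow> 'a topology \<Rightarrow>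
      ((((nat \<Rightarrow> real) \<Rightarrow> 'a) \<Rightarrow> 'r::comm_ring_1) \<times> (((nat \<Rightarrow> real) \<Rightarrow> 'a) \<Rightarrow> 'r)) set"
  where "cohomologous p X =
    {(c, c'). c \<in> cocycles p X \<and> c' \<in> cocycles p X \<and> (\<lambda>s. c s - c' s) \<in> coboundaries p X}"

definition cohomology :: "nat \<Rightarrow> 'a topology \<Rightarrow> (((nat \<Rightarrow> real) \<Rightarrow> 'a) \<Rightarrow> 'r::comm_ring_1) set set"
  where "cohomology p X = cocycles p X // cohomologous p X"

text \<open>
  Cohomology classes are homogeneous: an element of \<open>H\<^sup>*(X;R)\<close> is represented by the pair of
  its degree and an element of the cohomology group in that degree.  The degree is carried
  explicitly because a set of cochains need not determine it.
\<close>

type_synonym ('a, 'r) cohomology_class = "nat \<times> (((nat \<Rightarrow> real) \<Rightarrow> 'a) \<Rightarrow> 'r) set"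

abbreviation cohomology_degree :: "('a, 'r) cohomology_class \<Rightarrow> nat"
  where "cohomology_degree \<equiv> fst"

definition cohomology_classes :: "'a topology \<Rightarrow> ('a, 'r::comm_ring_1) cohomology_class set"
  where "cohomology_classes X = (SIGMA p:UNIV. cohomology p X)"

definition cohomology_zero :: "nat \<Rightarrow> 'a topology \<Rightarrow> ('a, 'r::comm_ring_1) cohomology_class"
  where "cohomology_zero p X = (p, cohomologous p X `` {\<lambda>s. 0})"

text \<open>Only meaningful when both classes have the same degree.\<close>

fun class_diff ::
    "'a topology \<Rightarrow> ('a, 'r::comm_ring_1) cohomology_class \<Rightarrow> ('a, 'r) cohomology_class
      \<Rightarrow> ('a, 'r) cohomology_class"
  where "class_diff X (p, u) (q, v) =
    (p, \<Union>c\<in>u. \<Union>d\<in>v. cohomologous p X `` {\<lambda>s. c s - d s})"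

definition cochain_pullback ::
    "nat \<Rightarrow> 'a topology \<Rightarrow> ('a \<Rightarrow> 'b) \<Rightarrow> (((nat \<Rightarrow> real) \<Rightarrow> 'b) \<Rightarrow> 'r::comm_ring_1)
      \<Rightarrow> ((nat \<Rightarrow> real) \<Rightarrow> 'a) \<Rightarrow> 'r"
  where "cochain_pullback p X f c =
    (\<lambda>s. if singular_simplex p X s then c (simplex_map p f s) else 0)"

text \<open>The homomorphism induced by a continuous map \<open>f\<close> with domain \<open>X\<close>.\<close>

fun pullback ::
    "'a topology \<Rightarrow> ('a \<Rightarrow> 'b) \<Rightarrow> ('b, 'r::comm_ring_1) cohomology_class
      \<Rightarrow> ('a, 'r) cohomology_class"
  where "pullback X f (p, u) =
    (p, \<Union>c\<in>u. cohomologous p X `` {cochain_pullback p X f c})"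

text \<open>
  The front p-face of a (p+q)-simplex spans the vertices 0,...,p and the back q-face spans the
  vertices p,...,p+q.  Barycentric coordinates are functions on all of \<open>nat\<close>, vanishing beyond
  the dimension, so the inclusion of the front face is the identity on points.
\<close>

definition front_face :: "nat \<Rightarrow> ((nat \<Rightarrow> real) \<Rightarrow> 'a) \<Rightarrow> (nat \<Rightarrow> real) \<Rightarrow> 'a"
  where "front_face p s = restrict s (standard_simplex p)"

definition back_face :: "nat \<Rightarrow> nat \<Rightarrow> ((nat \<Rightarrow> real) \<Rightarrow> 'a) \<Rightarrow> (nat \<Rightarrow> real) \<Rightarrow> 'a"
  where "back_face p q s =
    restrict (\<lambda>x. s (\<lambda>i. if i < p then 0 else x (i - p))) (standard_simplex q)"

definition cochain_cup ::
    "nat \<Rightarrow> nat \<Rightarrow> 'a topology \<Rightarrow> (((nat \<Rightarrow> real) \<Rightarrow> 'a) \<Rightarrow> 'r::comm_ring_1)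
      \<Rightarrow> (((nat \<Rightarrow> real) \<Rightarrow> 'a) \<Rightarrow> 'r) \<Rightarrow> ((nat \<Rightarrow> real) \<Rightarrow> 'a) \<Rightarrow> 'r"
  where "cochain_cup p q X c d =
    (\<lambda>s. if singular_simplex (p + q) X s then c (front_face p s) * d (back_face p q s) else 0)"

fun cup ::
    "'a topology \<Rightarrow> ('a, 'r::comm_ring_1) cohomology_class \<Rightarrow> ('a, 'r) cohomology_class
      \<Rightarrow> ('a, 'r) cohomology_class"
  where "cup X (p, u) (q, v) =
    (p + q, \<Union>c\<in>u. \<Union>d\<in>v. cohomologous (p + q) X `` {cochain_cup p q X c d})"

text \<open>The product of \<open>u 0, \<dots>, u k\<close>, in this order.\<close>

primrec cup_prod ::
    "'a topology \<Rightarrow> (nat \<Rightarrow> ('a, 'r::comm_ring_1) cohomology_class) \<Rightarrow> nat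
      \<Rightarrow> ('a, 'r) cohomology_class"
  where
    "cup_prod X u 0 = u 0"
  | "cup_prod X u (Suc k) = cup X (cup_prod X u k) (u (Suc k))"

text \<open>
  The homogeneous elements of the image of \<open>f\<^sup>* - g\<^sup>*\<close>.  As this homomorphism preserves degrees,
  they are the images of the homogeneous elements.
\<close>

definition diff_image ::
    "'a topology \<Rightarrow> 'b topology \<Rightarrow> ('a \<Rightarrow> 'b) \<Rightarrow> ('a \<Rightarrow> 'b)
      \<Rightarrow> ('a, 'r::comm_ring_1) cohomology_class set"
  where "diff_image X Y f g =
    (\<lambda>v. class_diff X (pullback X f v) (pullback X g v)) ` cohomology_classes Y"

section \<open>CW complexes\<close>

definition closed_disc :: "nat \<Rightarrow> (nat \<Rightarrow> real) topology"
  where "closed_disc n = subtopology (Euclidean_space n) {x. (\<Sum>i<n. x i ^ 2) \<le> 1}"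

definition open_disc :: "nat \<Rightarrow> (nat \<Rightarrow> real) topology"
  where "open_disc n = subtopology (Euclidean_space n) {x. (\<Sum>i<n. x i ^ 2) < 1}"

text \<open>
  \<open>E\<close> is the set of open cells, \<open>n e\<close> the dimension and \<open>\<Phi> e\<close> the characteristic map of the cell
  \<open>e\<close>.  The last two conjuncts are closure-finiteness (the boundary of the disc is mapped into
  finitely many cells of smaller dimension) and the weak topology.
\<close>

definition cw_decomposition ::
    "'p topology \<Rightarrow> 'p set set \<Rightarrow> ('p set \<Rightarrow> nat) \<Rightarrow> ('p set \<Rightarrow> (nat \<Rightarrow> real) \<Rightarrow> 'p) \<Rightarrow> bool"
  where "cw_decomposition P E n \<Phi> \<longleftrightarrow>
    Hausdorff_space P \<and> \<Union>E = topspace P \<and> pairwise disjnt E \<and>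
    (\<forall>e\<in>E. continuous_map (closed_disc (n e)) P (\<Phi> e) \<and>
           homeomorphic_map (open_disc (n e)) (subtopology P e) (\<Phi> e)) \<and>
    (\<forall>e\<in>E. \<exists>F\<subseteq>E. finite F \<and> (\<forall>e'\<in>F. n e' < n e) \<and>
           \<Phi> e ` (topspace (closed_disc (n e)) - topspace (open_disc (n e))) \<subseteq> \<Union>F) \<and>
    (\<forall>A\<subseteq>topspace P. (\<forall>e\<in>E. closedin P (A \<inter> P closure_of e)) \<longrightarrow> closedin P A)"

definition cw_complex_of_dim :: "nat \<Rightarrow> 'p topology \<Rightarrow> bool"
  where "cw_complex_of_dim m P \<longleftrightarrow>
    (\<exists>E n \<Phi>. cw_decomposition P E n \<Phi> \<and> (\<forall>e\<in>E. n e \<le> m) \<and> (\<exists>e\<in>E. n e = m))"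

section \<open>Cohomological distance\<close>

text \<open>
  A definition cannot quantify over all types, so the points of the test complexes \<open>P\<close> have to be
  taken from a fixed type.  It is chosen so that nothing is lost: for nonempty \<open>U\<close>, the m-skeleton
  of the geometric realization of the singular set of \<open>U\<close> (one cell for each singular simplex of
  dimension at most m, degenerate or not) has as points the pairs of such a simplex and an interior
  point of the standard simplex, and equality of the two composites on this one complex forces
  equality of \<open>(f|\<^sub>U)\<^sup>*\<close> and \<open>(g|\<^sub>U)\<^sup>*\<close> in all degrees up to m, hence equality of the composites on
  every m-dimensional \<open>P\<close>, of whatever type.
\<close>

type_synonym 'a test_point = "((nat \<Rightarrow> real) \<Rightarrow> 'a) \<times> (nat \<Rightarrow> real)"

definition cohomologically_equal_on ::
    "'r::comm_ring_1 itself \<Rightarrow> nat \<Rightarrow> 'a topology \<Rightarrow> 'b topology \<Rightarrow> ('a \<Rightarrow> 'b) \<Rightarrow> ('a \<Rightarrow> 'b)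
      \<Rightarrow> 'a set \<Rightarrow> bool"
  where "cohomologically_equal_on R m X Y f g U \<longleftrightarrow>
    (\<forall>(P :: 'a test_point topology) \<phi>.
       cw_complex_of_dim m P \<longrightarrow> continuous_map P (subtopology X U) \<phi> \<longrightarrow>
       (\<forall>v :: ('b, 'r) cohomology_class. v \<in> cohomology_classes Y \<longrightarrow>
          pullback P \<phi> (pullback (subtopology X U) f v) =
          pullback P \<phi> (pullback (subtopology X U) g v)))"

text \<open>The value is \<open>\<infinity>\<close> if no finite cover exists.\<close>

definition cohomological_distance ::
    "'r::comm_ring_1 itself \<Rightarrow> nat \<Rightarrow> 'a topology \<Rightarrow> 'b topology \<Rightarrow> ('a \<Rightarrow> 'b) \<Rightarrow> ('a \<Rightarrow> 'b) \<Rightarrow> enat"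
  where "cohomological_distance R m X Y f g =
    Inf {enat k | k. \<exists>U :: nat \<Rightarrow> 'a set.
      (\<forall>i\<le>k. openin X (U i)) \<and> (\<Union>i\<le>k. U i) = topspace X \<and>
      (\<forall>i\<le>k. cohomologically_equal_on R m X Y f g (U i))}"

end

theory Submission
  imports Defs
begin

text \<open>
  Suppose that \<open>X\<close> is covered by open sets \<open>U 0, \<dots>, U n\<close> with \<open>n \<le> k\<close> on each of which \<open>f\<close> and \<open>g\<close> are
  indistinguishable by \<open>m\<close>-dimensional complexes.  The classical cup-length argument then applies:
  every \<open>u i\<close> becomes zero on \<open>U i\<close> (on \<open>U n\<close> if \<open>i > n\<close>), hence lifts to the cohomology of the pair \<open>(X, U i)\<close>,
  and the product of the lifts lies in the cohomology of \<open>X\<close> relative to the union of all the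
  \<open>U i\<close>, which is \<open>X\<close>.  So the product of the \<open>u i\<close> is zero.  Two points need an argument.

  The hypothesis on the cover speaks of maps from \<open>m\<close>-dimensional CW complexes to \<open>U i\<close>, whereas the
  argument needs \<open>u i\<close> to vanish on \<open>U i\<close> itself.  The bridge is one universal complex: the
  \<open>m\<close>-skeleton of the geometric realization of the singular set of \<open>U i\<close>, with one cell for
  every singular simplex of dimension at most \<open>m\<close>, degenerate ones included and not collapsed.  Evaluation
  \<open>(s, x) \<mapsto> s x\<close> maps it to \<open>U i\<close>, and every singular simplex \<open>s\<close> of \<open>U i\<close> is the composite of
  evaluation with the characteristic map of its own cell.  These tautological simplices are
  compatible with faces, so they form a chain-level section of evaluation in dimensions up to \<open>m\<close>;
  a primitive upstairs restricts along the section to a primitive on \<open>U i\<close>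
  (\<open>test_complex_exists\<close>, \<open>pullback_difference_coboundary_on\<close>).

  Relative cohomology of a cover is handled with cochains: \<open>u i\<close> has a representative that is zero
  on all simplices of \<open>U i\<close> (\<open>representative_vanishing_on\<close>), and the cup product of these
  representatives is a cocycle that is zero on every simplex contained in some \<open>U i\<close>.  Iterated
  subdivision shows that such a cocycle is a coboundary (\<open>cocycle_vanishing_on_small_simplices\<close>).

  That the realization is a CW complex is proved with explicit formulas.  A point is a pair
  of a simplex and an interior point of its parameter simplex; a boundary point of a cell is brought
  to this form by deleting vanishing barycentric coordinates.  Hausdorffness, and the continuity of
  the inverse of a characteristic map on the open cell, both come from one family of continuous
  functions on the whole realization (\<open>cell_coord\<close>), and closed discs are mapped to simplices by a
  closed formula that is invertible on the interior (\<open>disc_to_simplex\<close>).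
\<close>

section \<open>The cochain complex\<close>

text \<open>
  Cochains are functions on simplices; extending them linearly to chains makes the chain-level
  operators of singular homology, subdivision and its chain homotopy, available for them.
\<close>

definition chain_eval :: "('s \<Rightarrow> 'r::comm_ring_1) \<Rightarrow> ('s \<Rightarrow>\<^sub>0 int) \<Rightarrow> 'r"
  where "chain_eval w c = (\<Sum>s\<in>Poly_Mapping.keys c. of_int (Poly_Mapping.lookup c s) * w s)"

lemma chain_eval_superset:
  assumes "finite A" "Poly_Mapping.keys c \<subseteq> A"
  shows "chain_eval w c = (\<Sum>s\<in>A. of_int (Poly_Mapping.lookup c s) * w s)"
  unfolding chain_eval_def using assms
  by (intro sum.mono_neutral_left) (auto simp: in_keys_iff)

lemma chain_eval_0 [simp]: "chain_eval w 0 = 0"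
  by (simp add: chain_eval_def)

lemma chain_eval_of [simp]: "chain_eval w (frag_of s) = w s"
  by (simp add: chain_eval_def)

lemma chain_eval_diff: "chain_eval w (a - b) = chain_eval w a - chain_eval w b"
proof -
  let ?A = "Poly_Mapping.keys a \<union> Poly_Mapping.keys b"
  have "chain_eval w (a - b) = (\<Sum>s\<in>?A. of_int (Poly_Mapping.lookup (a - b) s) * w s)"
    by (rule chain_eval_superset) (use keys_diff[of a b] in auto)
  moreover have "chain_eval w a = (\<Sum>s\<in>?A. of_int (Poly_Mapping.lookup a s) * w s)"
    by (rule chain_eval_superset) auto
  moreover have "chain_eval w b = (\<Sum>s\<in>?A. of_int (Poly_Mapping.lookup b s) * w s)"
    by (rule chain_eval_superset) auto
  ultimately show ?thesis
    by (simp add: lookup_minus algebra_simps flip: sum_subtractf)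
qed

lemma chain_eval_uminus: "chain_eval w (- a) = - chain_eval w a"
  using chain_eval_diff[of w 0 a] by simp

lemma chain_eval_add: "chain_eval w (a + b) = chain_eval w a + chain_eval w b"
  using chain_eval_diff[of w a "- b"] by (simp add: chain_eval_uminus)

lemma chain_eval_sum: "chain_eval w (sum F I) = (\<Sum>i\<in>I. chain_eval w (F i))"
  by (induction I rule: infinite_finite_induct) (auto simp: chain_eval_add)

lemma chain_eval_sign: "chain_eval w (frag_cmul ((-1) ^ k) a) = (-1) ^ k * chain_eval w a"
  by (cases "even k") (auto simp: chain_eval_uminus)

lemma chain_eval_eq_0:
  assumes "\<And>s. s \<in> Poly_Mapping.keys c \<Longrightarrow> w s = 0"
  shows "chain_eval w c = 0"
  using assms by (simp add: chain_eval_def)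

lemma coboundary_eq_chain_eval:
  assumes "singular_simplex (Suc p) X s"
  shows "coboundary p X w s = chain_eval w (chain_boundary (Suc p) (frag_of s))"
  using assms
  by (simp add: coboundary_def chain_boundary_of chain_eval_sum chain_eval_sign del: sum.atMost_Suc)

lemma chain_eval_coboundary:
  assumes "singular_chain (Suc p) X c"
  shows "chain_eval (coboundary p X w) c = chain_eval w (chain_boundary (Suc p) c)"
  using assms unfolding singular_chain_def
proof (induction c rule: frag_induction)
  case (one s)
  then show ?case by (simp add: coboundary_eq_chain_eval)
next
  case (diff a b)
  then show ?case by (simp add: chain_eval_diff chain_boundary_diff)
qed simp

text \<open>
  As \<open>coboundary\<close> is the transpose of \<open>chain_boundary\<close>, this is the fact that a boundary has no boundary.
\<close>

lemma coboundary_coboundary: "coboundary (Suc p) X (coboundary p X w) = (\<lambda>s. 0)"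
proof
  fix s
  show "coboundary (Suc p) X (coboundary p X w) s = 0"
  proof (cases "singular_simplex (Suc (Suc p)) X s")
    case True
    then have s: "singular_chain (Suc (Suc p)) X (frag_of s)"
      by (simp add: singular_chain_of)
    then have "singular_chain (Suc p) X (chain_boundary (Suc (Suc p)) (frag_of s))"
      by (rule singular_chain_boundary_alt)
    then show ?thesis
      using chain_boundary_boundary[OF s]
      by (simp add: coboundary_eq_chain_eval[OF True] chain_eval_coboundary)
  qed (simp add: coboundary_def)
qed

lemma coboundary_diff:
  "coboundary p X (\<lambda>s. c s - d s) = (\<lambda>s. coboundary p X c s - coboundary p X d s)"
  by (rule ext) (simp add: coboundary_def algebra_simps sum_subtractf del: sum.atMost_Suc)

lemma coboundary_zero [simp]: "coboundary p X (\<lambda>s. 0) = (\<lambda>s. 0)"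
  by (simp add: coboundary_def fun_eq_iff)

lemma coboundary_cmul:
  "coboundary p X (\<lambda>s. a * c s) = (\<lambda>s. a * coboundary p X c s)"
  by (rule ext) (simp add: coboundary_def sum_distrib_left algebra_simps del: sum.atMost_Suc)

lemma coboundary_in_cochains [simp]: "coboundary p X c \<in> cochains (Suc p) X"
  by (simp add: cochains_def coboundary_def)

lemma diff_in_cochains:
  "c \<in> cochains p X \<Longrightarrow> d \<in> cochains p X \<Longrightarrow> (\<lambda>s. c s - d s) \<in> cochains p X"
  by (simp add: cochains_def)

lemma cmul_in_cochains: "c \<in> cochains p X \<Longrightarrow> (\<lambda>s. a * c s) \<in> cochains p X"
  by (simp add: cochains_def)

lemma zero_in_cocycles [simp]: "(\<lambda>s. 0) \<in> cocycles p X"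
  by (simp add: cocycles_def cochains_def)

lemma diff_in_cocycles:
  "c \<in> cocycles p X \<Longrightarrow> d \<in> cocycles p X \<Longrightarrow> (\<lambda>s. c s - d s) \<in> cocycles p X"
  by (simp add: cocycles_def diff_in_cochains coboundary_diff)

lemma zero_in_coboundaries [simp]: "(\<lambda>s. 0) \<in> coboundaries p X"
  by (cases p) (auto simp: coboundaries_def cochains_def intro!: image_eqI[of _ _ "\<lambda>s. 0"])

lemma diff_in_coboundaries:
  assumes "c \<in> coboundaries p X" "d \<in> coboundaries p X"
  shows "(\<lambda>s. c s - d s) \<in> coboundaries p X"
proof (cases p)
  case (Suc q)
  with assms show ?thesis
    by (auto simp: coboundaries_def coboundary_diff[symmetric] intro: diff_in_cochains)
qed (use assms in \<open>simp add: coboundaries_def\<close>)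

lemma add_in_coboundaries:
  assumes "c \<in> coboundaries p X" "d \<in> coboundaries p X"
  shows "(\<lambda>s. c s + d s) \<in> coboundaries p X"
  using diff_in_coboundaries[OF assms(1) diff_in_coboundaries[OF zero_in_coboundaries assms(2)]]
  by simp

lemma coboundaries_subset_cocycles: "coboundaries p X \<subseteq> cocycles p X"
  by (cases p) (auto simp: coboundaries_def coboundary_coboundary, auto simp: cocycles_def coboundary_coboundary)

lemma equiv_cohomologous: "equiv (cocycles p X) (cohomologous p X)"
proof (intro equivI)
  show "refl_on (cocycles p X) (cohomologous p X)"
    by (auto simp: refl_on_def cohomologous_def)
  show "sym (cohomologous p X)"
    unfolding sym_def cohomologous_def
    using diff_in_coboundaries[OF zero_in_coboundaries] by force
  show "trans (cohomologous p X)"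
    unfolding trans_def cohomologous_def
    using add_in_coboundaries by (fastforce)
qed (auto simp: cohomologous_def)

definition cohomology_class :: "nat \<Rightarrow> 'a topology \<Rightarrow> (((nat \<Rightarrow> real) \<Rightarrow> 'a) \<Rightarrow> 'r::comm_ring_1)
    \<Rightarrow> (((nat \<Rightarrow> real) \<Rightarrow> 'a) \<Rightarrow> 'r) set"
  where "cohomology_class p X c = cohomologous p X `` {c}"

text \<open>
  Together with the formulas for \<open>class_diff\<close>, \<open>pullback\<close> and \<open>cup\<close> on classes of cocycles below, this
  reduces statements about sets of cochains to statements about single representatives.
\<close>

lemma cohomology_class_eq_iff:
  assumes "c \<in> cocycles p X" "d \<in> cocycles p X"
  shows "cohomology_class p X c = cohomology_class p X d \<longleftrightarrow> (\<lambda>s. c s - d s) \<in> coboundaries p X"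
  unfolding cohomology_class_def eq_equiv_class_iff[OF equiv_cohomologous assms]
  using assms by (simp add: cohomologous_def)

lemma in_cohomology_class_iff:
  "d \<in> cohomology_class p X c \<longleftrightarrow>
    c \<in> cocycles p X \<and> d \<in> cocycles p X \<and> (\<lambda>s. c s - d s) \<in> coboundaries p X"
  by (simp add: cohomology_class_def cohomologous_def)

lemma self_in_cohomology_class: "c \<in> cocycles p X \<Longrightarrow> c \<in> cohomology_class p X c"
  by (simp add: in_cohomology_class_iff)

lemma cohomology_class_eqI: "d \<in> cohomology_class p X c \<Longrightarrow> cohomology_class p X d = cohomology_class p X c"
  by (metis cohomology_class_def cohomology_class_eq_iff in_cohomology_class_iff)

lemma cohomology_eq_classes: "cohomology p X = cohomology_class p X ` cocycles p X"
  by (auto simp: cohomology_def quotient_def cohomology_class_def)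

lemma Union_constant:
  assumes "x \<in> A" "\<And>y. y \<in> A \<Longrightarrow> F y = B"
  shows "(\<Union>y\<in>A. F y) = B"
  using assms by auto

text \<open>
  Changing either representative by a coboundary changes the difference by a coboundary, so the
  union in the definition of \<open>class_diff\<close> is taken over equal sets.
\<close>

lemma class_diff_cohomology_class:
  assumes "c \<in> cocycles p X" "d \<in> cocycles p X"
  shows "class_diff X (p, cohomology_class p X c) (p, cohomology_class p X d) =
    (p, cohomology_class p X (\<lambda>s. c s - d s))"
proof -
  have "cohomology_class p X (\<lambda>s. c' s - d' s) = cohomology_class p X (\<lambda>s. c s - d s)"
    if "c' \<in> cohomology_class p X c" "d' \<in> cohomology_class p X d" for c' d'
  proof (rule cohomology_class_eqI)
    have "(\<lambda>s. (c s - c' s) - (d s - d' s)) \<in> coboundaries p X"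
      using that by (auto simp: in_cohomology_class_iff intro: diff_in_coboundaries)
    with that show "(\<lambda>s. c' s - d' s) \<in> cohomology_class p X (\<lambda>s. c s - d s)"
      by (simp add: in_cohomology_class_iff diff_in_cocycles algebra_simps)
  qed
  then show ?thesis
    using assms
    by (auto simp flip: cohomology_class_def intro!: Union_constant self_in_cohomology_class)
qed

section \<open>Induced homomorphisms\<close>

lemma simplex_map_singular_face:
  assumes "1 \<le> p" "k \<le> p"
  shows "simplex_map (p - 1) f (singular_face p k s) = singular_face p k (simplex_map p f s)"
  using assms simplical_face_in_standard_simplex[OF assms]
  by (auto simp: simplex_map_def singular_face_def fun_eq_iff)

lemma cochain_pullback_in_cochains [simp]: "cochain_pullback p X f c \<in> cochains p X"
  by (simp add: cochain_pullback_def cochains_def)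

lemma coboundary_cochain_pullback:
  assumes "continuous_map X Y f"
  shows "coboundary p X (cochain_pullback p X f c) = cochain_pullback (Suc p) X f (coboundary p Y c)"
proof
  fix s
  show "coboundary p X (cochain_pullback p X f c) s = cochain_pullback (Suc p) X f (coboundary p Y c) s"
  proof (cases "singular_simplex (Suc p) X s")
    case True
    have "cochain_pullback p X f c (singular_face (Suc p) k s) =
        c (singular_face (Suc p) k (simplex_map (Suc p) f s))" if "k \<le> Suc p" for k
      using singular_simplex_singular_face[OF True _ that] simplex_map_singular_face[OF _ that, of f s]
      by (simp add: cochain_pullback_def)
    then show ?thesis
      using True singular_simplex_simplex_map[OF True assms]
      by (simp add: coboundary_def cochain_pullback_def del: sum.atMost_Suc)
  qed (simp add: coboundary_def cochain_pullback_def)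
qed

lemma cochain_pullback_diff:
  "cochain_pullback p X f (\<lambda>s. c s - d s) =
    (\<lambda>s. cochain_pullback p X f c s - cochain_pullback p X f d s)"
  by (auto simp: cochain_pullback_def)

lemma cochain_pullback_zero [simp]: "cochain_pullback p X f (\<lambda>s. 0) = (\<lambda>s. 0)"
  by (auto simp: cochain_pullback_def)

lemma cochain_pullback_in_cocycles:
  assumes "continuous_map X Y f" "c \<in> cocycles p Y"
  shows "cochain_pullback p X f c \<in> cocycles p X"
  using assms by (simp add: cocycles_def coboundary_cochain_pullback)

lemma cochain_pullback_in_coboundaries:
  assumes "continuous_map X Y f" "c \<in> coboundaries p Y"
  shows "cochain_pullback p X f c \<in> coboundaries p X"
proof (cases p)
  case (Suc q)
  with assms show ?thesis
    by (auto simp: coboundaries_def coboundary_cochain_pullback[OF assms(1), symmetric])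
qed (use assms in \<open>simp add: coboundaries_def\<close>)

lemma pullback_cohomology_class:
  assumes f: "continuous_map X Y f" and c: "c \<in> cocycles p Y"
  shows "pullback X f (p, cohomology_class p Y c) = (p, cohomology_class p X (cochain_pullback p X f c))"
proof -
  have "cohomology_class p X (cochain_pullback p X f d) = cohomology_class p X (cochain_pullback p X f c)"
    if "d \<in> cohomology_class p Y c" for d
    using that cochain_pullback_in_coboundaries[OF f, of "\<lambda>s. c s - d s" p]
    by (intro cohomology_class_eqI)
      (simp add: in_cohomology_class_iff cochain_pullback_in_cocycles[OF f] cochain_pullback_diff)
  then show ?thesis
    using c by (auto simp flip: cohomology_class_def intro!: Union_constant self_in_cohomology_class)
qed

section \<open>Cup products\<close>

lemma shift_in_standard_simplex:
  assumes "x \<in> standard_simplex q"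
  shows "(\<lambda>i. if i < p then 0 else x (i - p)) \<in> standard_simplex (p + q)"
proof -
  have "(\<Sum>i\<le>p+q. if i < p then 0 else x (i - p)) = (\<Sum>i\<in>{p..p+q}. x (i - p))"
    by (rule sum.mono_neutral_cong_right) auto
  also have "\<dots> = (\<Sum>i\<in>{0..q}. x i)"
    using sum.shift_bounds_cl_nat_ivl[of "\<lambda>i. x (i - p)" 0 p q] by (simp add: add.commute)
  finally show ?thesis
    using assms by (auto simp: standard_simplex_def atMost_atLeast0)
qed

lemma singular_simplex_front_face:
  assumes "singular_simplex (p + q) X s"
  shows "singular_simplex p X (front_face p s)"
proof -
  have "continuous_map (subtopology (powertop_real UNIV) (standard_simplex p)) X s"
    using assms standard_simplex_mono[of p "p+q"]
    by (auto simp: singular_simplex_def intro: continuous_map_from_subtopology_mono)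
  then show ?thesis
    by (auto simp: singular_simplex_def front_face_def intro: continuous_map_eq)
qed

lemma singular_simplex_back_face:
  assumes "singular_simplex (p + q) X s"
  shows "singular_simplex q X (back_face p q s)"
proof -
  let ?sh = "\<lambda>x::nat\<Rightarrow>real. \<lambda>i. if i < p then 0 else x (i - p)"
  have "continuous_map (powertop_real UNIV) euclideanreal (\<lambda>x. ?sh x i)" for i
    by (cases "i < p") (auto intro: continuous_map_product_projection)
  then have "continuous_map (subtopology (powertop_real UNIV) (standard_simplex q))
      (subtopology (powertop_real UNIV) (standard_simplex (p + q))) ?sh"
    using shift_in_standard_simplex[of _ q p]
    by (auto simp: continuous_map_in_subtopology continuous_map_componentwise_UNIV
        continuous_map_from_subtopology)
  then have "continuous_map (subtopology (powertop_real UNIV) (standard_simplex q)) X (s \<circ> ?sh)"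
    using assms by (auto simp: singular_simplex_def intro: continuous_map_compose)
  then show ?thesis
    by (auto simp: singular_simplex_def back_face_def o_def intro: continuous_map_eq)
qed

lemma front_face_singular_face_low:
  assumes "k \<le> p"
  shows "front_face p (singular_face (Suc (p + q)) k s) = singular_face (Suc p) k (front_face (Suc p) s)"
  using assms simplical_face_in_standard_simplex[of "Suc p" k] standard_simplex_mono[of p "p + q"]
  by (auto simp: front_face_def singular_face_def fun_eq_iff)

lemma singular_face_front_face_last:
  "singular_face (Suc p) (Suc p) (front_face (Suc p) s) = front_face p s"
proof -
  have "simplical_face (Suc p) x = x" if "x \<in> standard_simplex p" for x
    using that by (auto simp: simplical_face_def standard_simplex_def fun_eq_iff)
  then show ?thesis
    using standard_simplex_mono[of p "Suc p"]
    by (intro ext) (auto simp: front_face_def singular_face_def)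
qed

lemma front_face_singular_face_high:
  assumes "p < k"
  shows "front_face p (singular_face (Suc (p + q)) k s) = front_face p s"
proof -
  have "simplical_face k x = x" if "x \<in> standard_simplex p" for x
    using that assms by (auto simp: simplical_face_def standard_simplex_def fun_eq_iff)
  then show ?thesis
    using standard_simplex_mono[of p "p + q"]
    by (intro ext) (auto simp: front_face_def singular_face_def)
qed

lemma back_face_singular_face_low:
  assumes "k \<le> p"
  shows "back_face p q (singular_face (Suc (p + q)) k s) = back_face (Suc p) q s"
proof -
  have "simplical_face k (\<lambda>i. if i < p then 0 else x (i - p)) =
      (\<lambda>i. if i < Suc p then 0 else x (i - Suc p))" for x :: "nat \<Rightarrow> real"
    using assms by (auto simp: simplical_face_def fun_eq_iff)
  then show ?thesis
    using shift_in_standard_simplex[of _ q p]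
    by (intro ext) (auto simp: back_face_def singular_face_def)
qed

lemma back_face_singular_face_high:
  assumes "j \<le> Suc q"
  shows "singular_face (Suc q) j (back_face p (Suc q) s) =
    (if j = 0 then back_face (Suc p) q s else back_face p q (singular_face (Suc (p + q)) (p + j) s))"
proof -
  have *: "(\<lambda>i. if i < p then 0 else simplical_face j x (i - p)) =
      simplical_face (p + j) (\<lambda>i. if i < p then 0 else x (i - p))"
    if "j > 0" for x :: "nat \<Rightarrow> real"
    using that by (auto simp: simplical_face_def fun_eq_iff)
  have 0: "(\<lambda>i. if i < p then 0 else simplical_face 0 x (i - p)) =
      (\<lambda>i. if i < Suc p then 0 else x (i - Suc p))" for x :: "nat \<Rightarrow> real"
    by (auto simp: simplical_face_def fun_eq_iff)
  show ?thesis
    using shift_in_standard_simplex[of _ q p] simplical_face_in_standard_simplex[of "Suc q" j] assms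
    by (auto simp: back_face_def singular_face_def fun_eq_iff 0 *)
qed

lemma cochain_cup_in_cochains [simp]: "cochain_cup p q X c d \<in> cochains (p + q) X"
  by (simp add: cochain_cup_def cochains_def)

text \<open>
  The Leibniz rule.  Faces \<open>0, \<dots>, p\<close> of a \<open>(p + q + 1)\<close>-simplex affect only the front part and
  faces \<open>p + 1, \<dots>, p + q + 1\<close> only the back part.  The coboundaries of \<open>c\<close> and \<open>d\<close> each have one
  further term, the last face of the front and the first face of the back; up to sign both are
  the product of \<open>c\<close> on the front \<open>p\<close>-face with \<open>d\<close> on the back \<open>q\<close>-face, and they cancel.
\<close>

lemma coboundary_cochain_cup:
  assumes s: "singular_simplex (Suc (p + q)) X s"
  shows "coboundary (p + q) X (cochain_cup p q X c d) s =
    coboundary p X c (front_face (Suc p) s) * d (back_face (Suc p) q s) +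
    (-1) ^ p * c (front_face p s) * coboundary q X d (back_face p (Suc q) s)"
proof -
  define C where "C k = c (singular_face (Suc p) k (front_face (Suc p) s))" for k
  define D where "D j = d (singular_face (Suc q) j (back_face p (Suc q) s))" for j
  define c0 where "c0 = c (front_face p s)"
  define d0 where "d0 = d (back_face (Suc p) q s)"
  have ff: "singular_simplex (Suc p) X (front_face (Suc p) s)"
    using singular_simplex_front_face[of "Suc p" q] s by simp
  have bf: "singular_simplex (Suc q) X (back_face p (Suc q) s)"
    using singular_simplex_back_face[of p "Suc q"] s by simp
  have C_last: "C (Suc p) = c0"
    by (simp add: C_def c0_def singular_face_front_face_last)
  have D_first: "D 0 = d0"
    by (simp add: D_def d0_def back_face_singular_face_high)
  have face: "cochain_cup p q X c d (singular_face (Suc (p + q)) k s) =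
      c (front_face p (singular_face (Suc (p + q)) k s)) *
      d (back_face p q (singular_face (Suc (p + q)) k s))" if "k \<le> Suc (p + q)" for k
    using singular_simplex_singular_face[OF s _ that] by (simp add: cochain_cup_def)
  have low: "cochain_cup p q X c d (singular_face (Suc (p + q)) k s) = C k * d0" if "k \<le> p" for k
    using that face[of k]
    by (simp add: front_face_singular_face_low back_face_singular_face_low C_def d0_def)
  have high: "cochain_cup p q X c d (singular_face (Suc (p + q)) (k + Suc p) s) = c0 * D (Suc k)"
    if "k \<le> q" for k
    using that face[of "k + Suc p"]
    by (simp add: front_face_singular_face_high D_def c0_def back_face_singular_face_high add.commute)
  have "coboundary (p + q) X (cochain_cup p q X c d) s =
      (\<Sum>k\<le>Suc (p + q). (-1) ^ k * cochain_cup p q X c d (singular_face (Suc (p + q)) k s))"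
    using s by (simp add: coboundary_def)
  also have "{..Suc (p + q)} = {..p} \<union> {0 + Suc p..q + Suc p}"
    by auto
  also have "(\<Sum>k\<in>\<dots>. (-1) ^ k * cochain_cup p q X c d (singular_face (Suc (p + q)) k s)) =
      (\<Sum>k\<le>p. (-1) ^ k * cochain_cup p q X c d (singular_face (Suc (p + q)) k s)) +
      (\<Sum>k\<in>{0 + Suc p..q + Suc p}. (-1) ^ k * cochain_cup p q X c d (singular_face (Suc (p + q)) k s))"
    by (rule sum.union_disjoint) auto
  also have "(\<Sum>k\<le>p. (-1) ^ k * cochain_cup p q X c d (singular_face (Suc (p + q)) k s)) =
      (\<Sum>k\<le>p. (-1) ^ k * C k) * d0"
    by (simp add: sum_distrib_right mult.assoc low)
  also have "(\<Sum>k\<in>{0 + Suc p..q + Suc p}. (-1) ^ k * cochain_cup p q X c d (singular_face (Suc (p + q)) k s)) =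
      (\<Sum>k\<in>{0..q}. (-1) ^ (k + Suc p) * (c0 * D (Suc k)))"
    by (subst sum.shift_bounds_cl_nat_ivl) (rule sum.cong, simp_all add: high del: add_Suc_right)
  also have "\<dots> = (-1) ^ p * c0 * (\<Sum>k\<le>q. (-1) ^ Suc k * D (Suc k))"
    by (simp add: sum_distrib_left atMost_atLeast0 power_add mult_ac)
  also have "(\<Sum>k\<le>q. (-1) ^ Suc k * D (Suc k)) = (\<Sum>k\<le>Suc q. (-1) ^ k * D k) - d0"
    using sum.atMost_Suc_shift[of "\<lambda>k. (-1) ^ k * D k" q] by (simp add: D_first del: sum.atMost_Suc)
  also have "(\<Sum>k\<le>p. (-1) ^ k * C k) = (\<Sum>k\<le>Suc p. (-1) ^ k * C k) + (-1) ^ p * c0"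
    by (simp add: C_last)
  finally show ?thesis
    using ff bf by (simp add: coboundary_def C_def D_def c0_def d0_def algebra_simps del: sum.atMost_Suc)
qed

lemma cochain_cup_diff_left:
  "cochain_cup p q X (\<lambda>s. c s - c' s) d = (\<lambda>s. cochain_cup p q X c d s - cochain_cup p q X c' d s)"
  by (auto simp: cochain_cup_def algebra_simps)

lemma cochain_cup_diff_right:
  "cochain_cup p q X c (\<lambda>s. d s - d' s) = (\<lambda>s. cochain_cup p q X c d s - cochain_cup p q X c d' s)"
  by (auto simp: cochain_cup_def algebra_simps)

lemma cochain_cup_in_cocycles:
  assumes "c \<in> cocycles p X" "d \<in> cocycles q X"
  shows "cochain_cup p q X c d \<in> cocycles (p + q) X"
proof -
  have "coboundary (p + q) X (cochain_cup p q X c d) s = 0" for s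
  proof (cases "singular_simplex (Suc (p + q)) X s")
    case True
    then show ?thesis
      using assms by (simp add: coboundary_cochain_cup cocycles_def)
  qed (simp add: coboundary_def)
  then show ?thesis
    by (auto simp: cocycles_def)
qed

text \<open>
  By the Leibniz rule a primitive of \<open>c\<close> multiplied by the cocycle \<open>d\<close> is a primitive of the product.
\<close>

lemma cochain_cup_coboundary_left:
  assumes c: "c \<in> coboundaries p X" and d: "d \<in> cocycles q X"
  shows "cochain_cup p q X c d \<in> coboundaries (p + q) X"
proof (cases p)
  case 0
  then have "cochain_cup p q X c d = (\<lambda>s. 0)"
    using c by (auto simp: coboundaries_def cochain_cup_def)
  then show ?thesis by simp
next
  case (Suc r)
  with c obtain b where b: "c = coboundary r X b"
    by (auto simp: coboundaries_def)
  have "cochain_cup p q X c d s = coboundary (r + q) X (cochain_cup r q X b d) s" for s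
  proof (cases "singular_simplex (Suc (r + q)) X s")
    case True
    then show ?thesis
      using d Suc b by (simp add: coboundary_cochain_cup cocycles_def cochain_cup_def[of "Suc r" q])
  qed (simp add: cochain_cup_def coboundary_def Suc)
  then have "cochain_cup p q X c d = coboundary (r + q) X (cochain_cup r q X b d)"
    by blast
  then show ?thesis
    by (simp add: coboundaries_def Suc)
qed

lemma cochain_cup_coboundary_right:
  assumes c: "c \<in> cocycles p X" and d: "d \<in> coboundaries q X"
  shows "cochain_cup p q X c d \<in> coboundaries (p + q) X"
proof (cases q)
  case 0
  then have "cochain_cup p q X c d = (\<lambda>s. 0)"
    using d by (auto simp: coboundaries_def cochain_cup_def)
  then show ?thesis by simp
next
  case (Suc r)
  with d obtain b where b: "d = coboundary r X b"
    by (auto simp: coboundaries_def)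
  let ?e = "\<lambda>s. (-1) ^ p * cochain_cup p r X c b s"
  have "cochain_cup p q X c d s = coboundary (p + r) X ?e s" for s
  proof (cases "singular_simplex (Suc (p + r)) X s")
    case True
    have [simp]: "(-1::'b) ^ p * ((-1) ^ p * z) = z" for z
      by (simp flip: mult.assoc power_mult_distrib)
    show ?thesis
      using c Suc b True
      by (simp add: coboundary_cochain_cup cocycles_def cochain_cup_def[of p "Suc r"] coboundary_cmul mult.assoc)
  qed (simp add: cochain_cup_def coboundary_def Suc)
  then have "cochain_cup p q X c d = coboundary (p + r) X ?e"
    by blast
  then show ?thesis
    by (simp add: coboundaries_def Suc cmul_in_cochains)
qed

lemma cup_cohomology_class:
  assumes c: "c \<in> cocycles p X" and d: "d \<in> cocycles q X"
  shows "cup X (p, cohomology_class p X c) (q, cohomology_class q X d) =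
    (p + q, cohomology_class (p + q) X (cochain_cup p q X c d))"
proof -
  have "cohomology_class (p + q) X (cochain_cup p q X c' d') =
      cohomology_class (p + q) X (cochain_cup p q X c d)"
    if c': "c' \<in> cohomology_class p X c" and d': "d' \<in> cohomology_class q X d" for c' d'
  proof (rule cohomology_class_eqI)
    have "cochain_cup p q X (\<lambda>s. c s - c' s) d \<in> coboundaries (p + q) X"
      using c' d by (intro cochain_cup_coboundary_left) (auto simp: in_cohomology_class_iff)
    moreover have "cochain_cup p q X c' (\<lambda>s. d s - d' s) \<in> coboundaries (p + q) X"
      using c' d' by (intro cochain_cup_coboundary_right) (auto simp: in_cohomology_class_iff)
    ultimately have "(\<lambda>s. cochain_cup p q X c d s - cochain_cup p q X c' d' s) \<in> coboundaries (p + q) X"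
      using add_in_coboundaries by (fastforce simp: cochain_cup_diff_left cochain_cup_diff_right)
    then show "cochain_cup p q X c' d' \<in> cohomology_class (p + q) X (cochain_cup p q X c d)"
      using c' d' by (simp add: in_cohomology_class_iff cochain_cup_in_cocycles)
  qed
  then show ?thesis
    using c d
    by (auto simp flip: cohomology_class_def intro!: Union_constant self_in_cohomology_class)
qed

text \<open>
  A representative of \<open>cup_prod\<close>, where \<open>c i\<close> is a cocycle of degree \<open>p i\<close> representing the \<open>i\<close>-th factor.
\<close>

primrec cochain_cup_prod ::
    "'a topology \<Rightarrow> (nat \<Rightarrow> nat) \<Rightarrow> (nat \<Rightarrow> ((nat \<Rightarrow> real) \<Rightarrow> 'a) \<Rightarrow> 'r::comm_ring_1) \<Rightarrow> nat
      \<Rightarrow> ((nat \<Rightarrow> real) \<Rightarrow> 'a) \<Rightarrow> 'r"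
  where
    "cochain_cup_prod X p c 0 = c 0"
  | "cochain_cup_prod X p c (Suc k) =
      cochain_cup (\<Sum>i\<le>k. p i) (p (Suc k)) X (cochain_cup_prod X p c k) (c (Suc k))"

lemma cochain_cup_prod_in_cocycles:
  "(\<And>i. i \<le> k \<Longrightarrow> c i \<in> cocycles (p i) X) \<Longrightarrow> cochain_cup_prod X p c k \<in> cocycles (\<Sum>i\<le>k. p i) X"
  by (induction k) (auto intro: cochain_cup_in_cocycles)

lemma cup_prod_cohomology_class:
  assumes "\<And>i. i \<le> k \<Longrightarrow> c i \<in> cocycles (p i) X"
    and "\<And>i. i \<le> k \<Longrightarrow> u i = (p i, cohomology_class (p i) X (c i))"
  shows "cup_prod X u k =
    (\<Sum>i\<le>k. p i, cohomology_class (\<Sum>i\<le>k. p i) X (cochain_cup_prod X p c k))"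
  using assms
  by (induction k) (simp_all add: cup_cohomology_class cochain_cup_prod_in_cocycles del: cup.simps)

text \<open>
  Front and back faces of a simplex in \<open>U\<close> lie in \<open>U\<close>, so a single factor that is zero on the
  simplices of \<open>U\<close> makes the whole product zero there.
\<close>

lemma cochain_cup_prod_vanishes_locally:
  assumes "\<And>t. singular_simplex (p j) (subtopology X U) t \<Longrightarrow> c j t = 0" "j \<le> k"
    and "singular_simplex (\<Sum>i\<le>k. p i) (subtopology X U) s"
  shows "cochain_cup_prod X p c k s = 0"
  using assms(2,3)
proof (induction k arbitrary: s)
  case 0
  then show ?case using assms(1) by simp
next
  case (Suc k)
  then have s: "singular_simplex ((\<Sum>i\<le>k. p i) + p (Suc k)) (subtopology X U) s"
    by simp
  show ?case
  proof (cases "j = Suc k")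
    case True
    then show ?thesis
      using assms(1) singular_simplex_back_face[OF s] by (simp add: cochain_cup_def)
  next
    case False
    then show ?thesis
      using Suc.IH[OF _ singular_simplex_front_face[OF s]] Suc.prems(1) by (simp add: cochain_cup_def)
  qed
qed

section \<open>Cocycles that vanish on small simplices\<close>

text \<open>
  The subdivision operator \<open>Sd\<close> is chain homotopic to the identity by a natural homotopy \<open>h\<close>, so
  \<open>T n = h + h Sd + \<dots> + h Sd\<^sup>n\<^sup>-\<^sup>1\<close> is a homotopy from the identity to \<open>Sd\<^sup>n\<close>.  For a cocycle \<open>w\<close> this
  gives \<open>w (T n (boundary s)) = w (Sd\<^sup>n s) - w s\<close>, and the first term on the right is zero once
  \<open>Sd\<^sup>n s\<close> consists of small simplices.  The number \<open>n\<close> depends on \<open>s\<close>, but since \<open>h\<close> preserves small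
  chains, \<open>w (T n e)\<close> no longer changes once \<open>Sd\<^sup>n e\<close> is small.  Hence \<open>- w (T n e)\<close> for
  large \<open>n\<close> is a well-defined cochain in \<open>e\<close>, and it is a primitive of \<open>w\<close>.
\<close>

lemma cocycle_vanishing_on_small_simplices:
  fixes w :: "((nat \<Rightarrow> real) \<Rightarrow> 'a) \<Rightarrow> 'r::comm_ring_1"
  assumes w: "w \<in> cocycles d X"
    and C: "\<And>U. U \<in> C \<Longrightarrow> openin X U" "topspace X \<subseteq> \<Union>C"
    and small: "\<And>U s. U \<in> C \<Longrightarrow> singular_simplex d (subtopology X U) s \<Longrightarrow> w s = 0"
  shows "w \<in> coboundaries d X"
proof (cases d)
  case 0
  have "w s = 0" for s
  proof (cases "singular_simplex d X s")
    case True
    then have "s ` standard_simplex 0 \<subseteq> topspace X"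
      using 0 by (auto simp: singular_simplex_def continuous_map_def)
    then obtain U where "U \<in> C" "s ` standard_simplex 0 \<subseteq> U"
      using C(2) by (auto simp: standard_simplex_0)
    with True 0 show ?thesis
      using small by (simp add: singular_simplex_subtopology)
  qed (use w in \<open>simp add: cocycles_def cochains_def\<close>)
  then show ?thesis
    using 0 by (auto simp: coboundaries_def)
next
  case (Suc q)
  let ?sd = "singular_subdivision"
  obtain h :: "nat \<Rightarrow> 'a chain \<Rightarrow> 'a chain" where h0: "\<And>p. h p 0 = 0"
    and hdiff: "\<And>p c1 c2. h p (c1 - c2) = h p c1 - h p c2"
    and hchain: "\<And>p X c. singular_chain p X c \<Longrightarrow> singular_chain (Suc p) X (h p c)"
    and hbd: "\<And>p X c. singular_chain p X c \<Longrightarrow>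
      chain_boundary (Suc p) (h p c) + h (p - Suc 0) (chain_boundary p c) = ?sd p c - c"
    using chain_homotopic_singular_subdivision by blast
  \<comment> \<open>Only the composite with \<open>w\<close> of the homotopy from the identity to the \<open>n\<close>-th subdivision is needed.\<close>
  define T where "T n e = (\<Sum>i<n. chain_eval w (h q ((?sd q ^^ i) e)))" for n e
  have T0: "T n 0 = 0" for n
    by (simp add: T_def h0)
  have Tdiff: "T n (a - b) = T n a - T n b" for n a b
    by (simp add: T_def singular_subdivision_power_diff hdiff chain_eval_diff sum_subtractf)
  have Tminus: "T n (- a) = - T n a" for n a
    using Tdiff[of n 0 a] by (simp add: T0)
  have Tadd: "T n (a + b) = T n a + T n b" for n a b
    using Tdiff[of n a "- b"] by (simp add: Tminus)
  have Tsum: "T n (sum F I) = (\<Sum>i\<in>I. T n (F i))" for n F and I :: "nat set"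
    by (induction I rule: infinite_finite_induct) (auto simp: Tadd T0)
  have Tsign: "T n (frag_cmul ((-1) ^ k) a) = (-1) ^ k * T n a" for n k a
    by (cases "even k") (auto simp: Tminus)

  define Small where "Small p = {s. \<exists>U\<in>C. singular_simplex p (subtopology X U) s}" for p
  have w_Small: "chain_eval w c = 0" if "Poly_Mapping.keys c \<subseteq> Small d" for c
    using that small by (intro chain_eval_eq_0) (auto simp: Small_def)
  have wh_Small: "chain_eval w (h q c) = 0" if "Poly_Mapping.keys c \<subseteq> Small q" for c
    using that
  proof (induction c rule: frag_induction)
    case (one s)
    then obtain U where U: "U \<in> C" "singular_simplex q (subtopology X U) s"
      by (auto simp: Small_def)
    then have "singular_chain d (subtopology X U) (h q (frag_of s))"
      using hchain[of q "subtopology X U"] Suc by (simp add: singular_chain_of)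
    then show ?case
      using U(1) by (intro w_Small) (auto simp: singular_chain_def Small_def)
  qed (simp_all add: h0 hdiff chain_eval_diff)
  have sdchain: "singular_chain p X ((?sd p ^^ n) c)" if "singular_chain p X c" for p n and c :: "'a chain"
    using that by (induction n) (auto simp: singular_chain_singular_subdivision)
  have ex_small: "\<exists>n. \<forall>m\<ge>n. Poly_Mapping.keys ((?sd p ^^ m) (frag_of s)) \<subseteq> Small p"
    if "singular_simplex p X s" for p s
  proof -
    have s: "singular_chain p X (frag_of s)"
      using that by (simp add: singular_chain_of)
    obtain n where n: "\<And>m f. \<lbrakk>n \<le> m; f \<in> Poly_Mapping.keys ((?sd p ^^ m) (frag_of s))\<rbrakk>
        \<Longrightarrow> \<exists>V \<in> C. f \<in> standard_simplex p \<rightarrow> V"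
      using sufficient_iterated_singular_subdivision_exists[OF C s] by metis
    have "f \<in> Small p" if "n \<le> m" "f \<in> Poly_Mapping.keys ((?sd p ^^ m) (frag_of s))" for m f
      using n[OF that] sdchain[OF s, of m] that(2)
      by (auto simp: Small_def singular_simplex_subtopology singular_chain_def Pi_iff)
    then show ?thesis by blast
  qed
  define N where "N p s = (SOME n. \<forall>m\<ge>n. Poly_Mapping.keys ((?sd p ^^ m) (frag_of s)) \<subseteq> Small p)"
    for p s
  have N: "Poly_Mapping.keys ((?sd p ^^ m) (frag_of s)) \<subseteq> Small p"
    if "singular_simplex p X s" "N p s \<le> m" for p s m
    using someI_ex[OF ex_small[OF that(1)]] that(2) by (simp add: N_def)
  \<comment> \<open>The eventual value of \<open>- T n\<close>.\<close>
  define b where "b e = (if singular_simplex q X e then - T (N q e) (frag_of e) else 0)" for e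
  have b: "b e = - T n (frag_of e)" if e: "singular_simplex q X e" and n: "N q e \<le> n" for e n
  proof -
    have "T n (frag_of e) = T (N q e) (frag_of e)"
      unfolding T_def
      using n by (intro sum.mono_neutral_right) (auto intro!: wh_Small N[OF e])
    then show ?thesis
      using e by (simp add: b_def)
  qed
  have "coboundary q X b s = w s" for s
  proof (cases "singular_simplex d X s")
    case True
    let ?F = "\<lambda>k. singular_face d k s"
    have F: "singular_simplex q X (?F k)" if "k \<le> d" for k
      using singular_simplex_singular_face[OF True _ that] Suc by simp
    have s: "singular_chain d X (frag_of s)"
      using True by (simp add: singular_chain_of)
    define n where "n = Max (insert (N d s) ((\<lambda>k. N q (?F k)) ` {..d}))"
    have n: "N d s \<le> n" "\<And>k. k \<le> d \<Longrightarrow> N q (?F k) \<le> n"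
      by (simp_all add: n_def del: Max_insert)
    have bd_sd: "chain_boundary d ((?sd d ^^ i) (frag_of s)) = (?sd q ^^ i) (chain_boundary d (frag_of s))"
      for i
      using sdchain[OF s] Suc
      by (induction i) (auto simp: chain_boundary_singular_subdivision[where X=X])
    have step: "chain_eval w (h q ((?sd q ^^ i) (chain_boundary d (frag_of s)))) =
        chain_eval w ((?sd d ^^ Suc i) (frag_of s)) - chain_eval w ((?sd d ^^ i) (frag_of s))" for i
    proof -
      let ?c = "(?sd d ^^ i) (frag_of s)"
      have "h q (chain_boundary d ?c) = ?sd d ?c - ?c - chain_boundary (Suc d) (h d ?c)"
        using hbd[OF sdchain[OF s, of i]] Suc by (simp add: algebra_simps)
      moreover have "chain_eval w (chain_boundary (Suc d) (h d ?c)) = 0"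
        using chain_eval_coboundary[OF hchain[OF sdchain[OF s, of i]], of w] w
        by (simp add: cocycles_def chain_eval_eq_0)
      ultimately show ?thesis
        by (simp add: chain_eval_diff flip: bd_sd)
    qed
    have "coboundary q X b s = (\<Sum>k\<le>d. (-1) ^ k * b (?F k))"
      using True Suc by (simp add: coboundary_def)
    also have "\<dots> = (\<Sum>k\<le>d. - ((-1) ^ k * T n (frag_of (?F k))))"
      by (rule sum.cong) (simp_all add: b[OF F n(2)])
    also have "\<dots> = - T n (chain_boundary d (frag_of s))"
      using Suc by (simp add: chain_boundary_of Tsum Tsign sum_negf del: sum.atMost_Suc)
    also have "\<dots> = - (chain_eval w ((?sd d ^^ n) (frag_of s)) - w s)"
      unfolding T_def step by (subst sum_lessThan_telescope) simp
    also have "\<dots> = w s"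
      using w_Small[OF N[OF True n(1)]] by simp
    finally show ?thesis .
  next
    case False
    then show ?thesis
      using w Suc by (simp add: coboundary_def cocycles_def cochains_def)
  qed
  then have "w = coboundary q X b"
    by auto
  moreover have "b \<in> cochains q X"
    by (simp add: cochains_def b_def)
  ultimately show ?thesis
    by (simp add: coboundaries_def Suc)
qed

section \<open>Deleting a coordinate\<close>

text \<open>
  A left inverse of the face inclusion \<open>simplical_face k\<close>.  It is defined on all sequences, not only
  on the face where the \<open>k\<close>-th coordinate is zero; \<open>bump\<close> below depends on this.
\<close>

definition delete_coord :: "nat \<Rightarrow> (nat \<Rightarrow> 'b) \<Rightarrow> nat \<Rightarrow> 'b"
  where "delete_coord k x = (\<lambda>i. if i < k then x i else x (Suc i))"

lemma delete_coord_simplical_face [simp]: "delete_coord k (simplical_face k x) = x"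
  by (auto simp: delete_coord_def simplical_face_def fun_eq_iff)

lemma simplical_face_delete_coord: "x k = 0 \<Longrightarrow> simplical_face k (delete_coord k x) = x"
  by (auto simp: delete_coord_def simplical_face_def fun_eq_iff)

lemma delete_coord_delete_coord:
  "i \<le> j \<Longrightarrow> delete_coord i (delete_coord (Suc j) x) = delete_coord j (delete_coord i x)"
  by (auto simp: delete_coord_def fun_eq_iff)

text \<open>
  Stated for arbitrary sequences, as it is used both for barycentric coordinates and for
  sums over the faces of a simplex with one face left out.
\<close>

lemma sum_delete_coord:
  fixes x :: "nat \<Rightarrow> 'b::comm_monoid_add"
  assumes "k \<le> Suc p"
  shows "(\<Sum>i\<le>p. delete_coord k x i) + x k = (\<Sum>i\<le>Suc p. x i)"
  using assms
proof (induction p)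
  case 0
  then have "k = 0 \<or> k = 1" by auto
  then show ?case by (auto simp: delete_coord_def add.commute)
next
  case (Suc p)
  show ?case
  proof (cases "k = Suc (Suc p)")
    case True
    then have "(\<Sum>i\<le>Suc p. delete_coord k x i) = (\<Sum>i\<le>Suc p. x i)"
      by (intro sum.cong) (auto simp: delete_coord_def)
    with True show ?thesis by simp
  next
    case False
    then have "delete_coord k x (Suc p) = x (Suc (Suc p))"
      using Suc.prems by (simp add: delete_coord_def)
    then have "(\<Sum>i\<le>Suc p. delete_coord k x i) + x k =
        ((\<Sum>i\<le>p. delete_coord k x i) + x k) + x (Suc (Suc p))"
      by (simp add: add_ac)
    also have "\<dots> = (\<Sum>i\<le>Suc p. x i) + x (Suc (Suc p))"
      using Suc.IH Suc.prems False by (metis le_Suc_eq)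
    finally show ?thesis by simp
  qed
qed

lemma delete_coord_in_standard_simplex:
  assumes "x \<in> standard_simplex (Suc p)" "x k = 0" "k \<le> Suc p"
  shows "delete_coord k x \<in> standard_simplex p"
  using assms sum_delete_coord[OF assms(3), of x]
  by (auto simp: standard_simplex_def delete_coord_def[of k x])

lemma singular_face_singular_face:
  assumes "i \<le> j" "j \<le> Suc p"
  shows "singular_face (Suc p) i (singular_face (Suc (Suc p)) (Suc j) s) =
    singular_face (Suc p) j (singular_face (Suc (Suc p)) i s)"
proof
  fix t :: "nat \<Rightarrow> real"
  have "simplical_face (Suc j) (simplical_face i t) = simplical_face i (simplical_face j t)"
    using assms(1) by (auto simp: simplical_face_def fun_eq_iff)
  then show "singular_face (Suc p) i (singular_face (Suc (Suc p)) (Suc j) s) t =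
    singular_face (Suc p) j (singular_face (Suc (Suc p)) i s) t"
    using assms simplical_face_in_standard_simplex[of "Suc p" i t] simplical_face_in_standard_simplex[of "Suc p" j t]
    by (simp add: singular_face_def)
qed

lemma continuous_map_delete_coord:
  "continuous_map (powertop_real UNIV) (powertop_real UNIV) (delete_coord k)"
  unfolding continuous_map_componentwise_UNIV delete_coord_def
  by (auto intro: continuous_map_product_projection)

section \<open>The open simplex\<close>

abbreviation simplex_topology :: "nat \<Rightarrow> (nat \<Rightarrow> real) topology"
  where "simplex_topology p \<equiv> subtopology (powertop_real UNIV) (standard_simplex p)"

definition open_simplex :: "nat \<Rightarrow> (nat \<Rightarrow> real) set"
  where "open_simplex p = {x \<in> standard_simplex p. \<forall>i\<le>p. 0 < x i}"

lemma open_simplex_subset: "open_simplex p \<subseteq> standard_simplex p"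
  by (auto simp: open_simplex_def)

lemma open_simplex_dim_unique:
  assumes "x \<in> open_simplex p" "x \<in> open_simplex q"
  shows "p = q"
proof -
  have "\<not> a < b" if "x \<in> open_simplex a" "x \<in> open_simplex b" for a b
    using that by (auto simp: open_simplex_def standard_simplex_def)
  then show ?thesis
    using assms by (metis nat_neq_iff)
qed

definition barycenter :: "nat \<Rightarrow> nat \<Rightarrow> real"
  where "barycenter p = (\<lambda>i. if i \<le> p then 1 / (real p + 1) else 0)"

lemma barycenter_in_open_simplex: "barycenter p \<in> open_simplex p"
  by (auto simp: open_simplex_def standard_simplex_def barycenter_def field_simps)

lemma open_simplexI:
  assumes "x \<in> standard_simplex p" "\<And>i. i \<le> p \<Longrightarrow> x i \<noteq> 0"
  shows "x \<in> open_simplex p"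
  using assms by (auto simp: open_simplex_def standard_simplex_def order_less_le)

text \<open>
  Every point is the end of a segment coming from the barycenter whose other points are interior.
\<close>

lemma standard_simplex_subset_closure:
  "standard_simplex p \<subseteq> simplex_topology p closure_of open_simplex p"
proof
  fix x
  assume x: "x \<in> standard_simplex p"
  show "x \<in> simplex_topology p closure_of open_simplex p"
    unfolding in_closure_of
  proof (intro conjI allI impI)
    show "x \<in> topspace (simplex_topology p)"
      using x by simp
    fix T
    assume T: "x \<in> T \<and> openin (simplex_topology p) T"
    let ?\<gamma> = "\<lambda>t i. (1 - t) * x i + t * barycenter p i"
    have b: "barycenter p \<in> standard_simplex p"
      using barycenter_in_open_simplex open_simplex_subset by blast
    have "continuous_map (subtopology euclideanreal {0..1}) (simplex_topology p) ?\<gamma>"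
      unfolding continuous_map_in_subtopology continuous_map_componentwise_UNIV
    proof (intro conjI allI)
      show "continuous_map (subtopology euclideanreal {0..1}) euclideanreal (\<lambda>t. ?\<gamma> t i)" for i
        by (intro continuous_intros) auto
      show "?\<gamma> \<in> topspace (subtopology euclideanreal {0..1}) \<rightarrow> standard_simplex p"
        using convex_standard_simplex[OF x b] by simp
    qed
    from openin_continuous_map_preimage[OF this, of T]
    have "openin (subtopology euclideanreal {0..1}) {t \<in> {0..1}. ?\<gamma> t \<in> T}"
      using T by simp
    then obtain S where "open S" and S: "{t \<in> {0..1}. ?\<gamma> t \<in> T} = S \<inter> {0..1}"
      unfolding openin_subtopology by (metis open_openin)
    have S_iff: "t \<in> S \<longleftrightarrow> ?\<gamma> t \<in> T" if "0 \<le> t" "t \<le> 1" for t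
      using set_eq_iff[THEN iffD1, OF S, rule_format, of t] that by simp
    have "0 \<in> S"
      using T by (simp add: S_iff)
    then obtain e where e: "e > 0" "\<And>t. dist t 0 < e \<Longrightarrow> t \<in> S"
      using \<open>open S\<close> unfolding open_dist by blast
    define t where "t = min 1 (e / 2)"
    have t: "0 < t" "t \<le> 1"
      using e(1) by (auto simp: t_def)
    have "t \<in> S"
      using e(1) by (intro e(2)) (simp add: t_def dist_real_def)
    with t have "?\<gamma> t \<in> T"
      by (simp add: S_iff)
    moreover have "?\<gamma> t \<in> open_simplex p"
    proof -
      have "0 < ?\<gamma> t i" if "i \<le> p" for i
      proof (rule add_nonneg_pos)
        show "0 \<le> (1 - t) * x i"
          using t x by (simp add: standard_simplex_def)
        show "0 < t * barycenter p i"
          using t that barycenter_in_open_simplex[of p] by (simp add: open_simplex_def)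
      qed
      then show ?thesis
        using convex_standard_simplex[OF x b] t by (simp add: open_simplex_def)
    qed
    ultimately show "\<exists>y. y \<in> open_simplex p \<and> y \<in> T" by blast
  qed
qed

section \<open>Discs and simplices\<close>

definition min_coord :: "nat \<Rightarrow> (nat \<Rightarrow> real) \<Rightarrow> real"
  where "min_coord p x = Min (x ` {..p})"

lemma min_coord_le: "i \<le> p \<Longrightarrow> min_coord p x \<le> x i"
  by (simp add: min_coord_def)

lemma min_coord_attained: obtains i where "i \<le> p" "x i = min_coord p x"
proof -
  have "Min (x ` {..p}) \<in> x ` {..p}"
    by (rule Min_in) auto
  then obtain i where "i \<in> {..p}" "Min (x ` {..p}) = x i"
    by (rule imageE)
  then show thesis
    using that[of i] by (simp add: min_coord_def)
qed

lemma min_coord_eqI: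
  assumes "j \<le> p" "x j = a" "\<And>i. i \<le> p \<Longrightarrow> a \<le> x i"
  shows "min_coord p x = a"
  by (metis assms min_coord_le min_coord_attained order_antisym)

lemma continuous_map_min_coord:
  assumes "\<And>i. i \<le> p \<Longrightarrow> continuous_map X euclideanreal (\<lambda>a. x a i)"
  shows "continuous_map X euclideanreal (\<lambda>a. min_coord p (x a))"
  using assms
proof (induction p)
  case (Suc p)
  have "min_coord (Suc p) y = min (y (Suc p)) (min_coord p y)" for y
    by (simp add: min_coord_def atMost_Suc)
  with Suc show ?case
    by (auto intro!: continuous_intros)
qed (simp add: min_coord_def)

text \<open>
  The last coordinate of the point above \<open>x\<close> on the upper unit hemisphere; it vanishes exactly on
  the boundary sphere.
\<close>

definition disc_height :: "nat \<Rightarrow> (nat \<Rightarrow> real) \<Rightarrow> real"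
  where "disc_height p x = sqrt (1 - (\<Sum>i<p. x i ^ 2))"

text \<open>
  Unnormalized barycentric coordinates.  For \<open>x\<close> in the disc the coordinate \<open>x p\<close> is zero, so
  subtracting the minimum of \<open>x 0, \<dots>, x p\<close> gives nonnegative numbers of which one is zero, and
  the direction of \<open>x\<close> can be read off from their differences with the last one.  Adding the height
  makes all of them positive exactly in the interior.
\<close>

definition disc_weight :: "nat \<Rightarrow> (nat \<Rightarrow> real) \<Rightarrow> nat \<Rightarrow> real"
  where "disc_weight p x i = (if i \<le> p then x i - min_coord p x + disc_height p x else 0)"

definition disc_to_simplex :: "nat \<Rightarrow> (nat \<Rightarrow> real) \<Rightarrow> nat \<Rightarrow> real"
  where "disc_to_simplex p x = (\<lambda>i. disc_weight p x i / (\<Sum>j\<le>p. disc_weight p x j))"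

text \<open>
  Interior barycentric coordinates \<open>y\<close> determine \<open>(x, height)\<close> up to a positive factor, as the
  differences \<open>y i - y p\<close> together with the minimum of \<open>y\<close>.  As \<open>(x, height)\<close> lies on the unit sphere,
  the factor is the norm of this vector.
\<close>

definition simplex_scale :: "nat \<Rightarrow> (nat \<Rightarrow> real) \<Rightarrow> real"
  where "simplex_scale p y = sqrt ((\<Sum>i<p. (y i - y p) ^ 2) + min_coord p y ^ 2)"

definition simplex_to_disc :: "nat \<Rightarrow> (nat \<Rightarrow> real) \<Rightarrow> nat \<Rightarrow> real"
  where "simplex_to_disc p y = (\<lambda>i. if i < p then (y i - y p) / simplex_scale p y else 0)"

lemma topspace_closed_disc: "topspace (closed_disc p) = {x. (\<forall>i\<ge>p. x i = 0) \<and> (\<Sum>i<p. x i ^ 2) \<le> 1}"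
  by (auto simp: closed_disc_def topspace_Euclidean_space)

lemma topspace_open_disc: "topspace (open_disc p) = {x. (\<forall>i\<ge>p. x i = 0) \<and> (\<Sum>i<p. x i ^ 2) < 1}"
  by (auto simp: open_disc_def topspace_Euclidean_space)

lemma open_disc_subtopology: "open_disc p = subtopology (closed_disc p) (topspace (open_disc p))"
proof -
  have "{x. \<forall>i\<ge>p. x i = 0} \<inter> {x. (\<Sum>i<p. x i ^ 2) < 1} =
      {x. \<forall>i\<ge>p. x i = 0} \<inter> {x. (\<Sum>i<p. x i ^ 2) \<le> 1} \<inter> topspace (open_disc p)"
    by (auto simp: topspace_open_disc)
  then show ?thesis
    unfolding open_disc_def[of p] closed_disc_def Euclidean_space_def
    by (simp add: subtopology_subtopology Int_ac topspace_open_disc[of p] topspace_open_disc[unfolded open_disc_def Euclidean_space_def])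
qed

lemma disc_height_nonneg: "x \<in> topspace (closed_disc p) \<Longrightarrow> 0 \<le> disc_height p x"
  by (auto simp: topspace_closed_disc disc_height_def)

lemma disc_weight_nonneg:
  assumes "x \<in> topspace (closed_disc p)"
  shows "0 \<le> disc_weight p x i"
  using assms disc_height_nonneg min_coord_le[of i p x]
  by (simp add: disc_weight_def add_nonneg_nonneg)

text \<open>
  If all weights vanish, the height is zero and all coordinates of \<open>x\<close> equal \<open>x p = 0\<close>; but the height over
  the origin is 1.
\<close>

lemma sum_disc_weight_pos:
  assumes x: "x \<in> topspace (closed_disc p)"
  shows "0 < (\<Sum>j\<le>p. disc_weight p x j)"
proof (rule ccontr)
  assume "\<not> ?thesis"
  then have "(\<Sum>j\<le>p. disc_weight p x j) = 0"
    using disc_weight_nonneg[OF x] by (simp add: sum_nonneg order_antisym)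
  then have 0: "disc_weight p x j = 0" if "j \<le> p" for j
    using disc_weight_nonneg[OF x] that by (simp add: sum_nonneg_eq_0_iff)
  have min: "disc_height p x = 0 \<and> x j = min_coord p x" if "j \<le> p" for j
    using 0[OF that] disc_height_nonneg[OF x] min_coord_le[OF that, of x] that
    by (simp add: disc_weight_def)
  have "x p = 0"
    using x by (simp add: topspace_closed_disc)
  then have "x j = 0" if "j \<le> p" for j
    using min[OF that] min[of p] by simp
  then have "disc_height p x = 1"
    by (simp add: disc_height_def)
  with min show False by force
qed

lemma disc_to_simplex_in_standard_simplex:
  assumes x: "x \<in> topspace (closed_disc p)"
  shows "disc_to_simplex p x \<in> standard_simplex p"
proof -
  let ?S = "\<Sum>j\<le>p. disc_weight p x j"
  have S: "0 < ?S"
    using x by (rule sum_disc_weight_pos)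
  have "disc_weight p x i \<le> ?S" for i
  proof (cases "i \<le> p")
    case True
    then show ?thesis
      using disc_weight_nonneg[OF x] by (intro member_le_sum) auto
  qed (use S in \<open>simp add: disc_weight_def\<close>)
  moreover have "(\<Sum>i\<le>p. disc_weight p x i / ?S) = 1"
    using S by (simp flip: sum_divide_distrib)
  ultimately show ?thesis
    using S disc_weight_nonneg[OF x]
    by (auto simp: standard_simplex_def disc_to_simplex_def disc_weight_def[of p x])
qed

lemma disc_to_simplex_in_open_simplex_iff:
  assumes x: "x \<in> topspace (closed_disc p)"
  shows "disc_to_simplex p x \<in> open_simplex p \<longleftrightarrow> x \<in> topspace (open_disc p)"
proof -
  have S: "0 < (\<Sum>j\<le>p. disc_weight p x j)"
    using x by (rule sum_disc_weight_pos)
  have "disc_to_simplex p x \<in> open_simplex p \<longleftrightarrow> (\<forall>i\<le>p. 0 < disc_weight p x i)"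
    using disc_to_simplex_in_standard_simplex[OF x] S
    by (simp add: open_simplex_def disc_to_simplex_def zero_less_divide_iff)
  also have "\<dots> \<longleftrightarrow> 0 < disc_height p x"
  proof
    assume *: "\<forall>i\<le>p. 0 < disc_weight p x i"
    obtain i where "i \<le> p" "x i = min_coord p x"
      by (rule min_coord_attained)
    then show "0 < disc_height p x"
      using * by (auto simp: disc_weight_def)
  next
    assume "0 < disc_height p x"
    then show "\<forall>i\<le>p. 0 < disc_weight p x i"
      using min_coord_le[of _ p x] by (simp add: disc_weight_def add_nonneg_pos)
  qed
  also have "\<dots> \<longleftrightarrow> x \<in> topspace (open_disc p)"
    using x by (auto simp: topspace_open_disc topspace_closed_disc disc_height_def)
  finally show ?thesis .
qed

lemma continuous_map_closed_disc_coord: "continuous_map (closed_disc p) euclideanreal (\<lambda>x. x i)"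
  unfolding closed_disc_def Euclidean_space_def subtopology_subtopology
  by (intro continuous_map_from_subtopology continuous_map_product_projection) simp

lemma continuous_map_disc_to_simplex:
  "continuous_map (closed_disc p) (simplex_topology p) (disc_to_simplex p)"
proof -
  have h: "continuous_map (closed_disc p) euclideanreal (disc_height p)"
    unfolding disc_height_def
    by (intro continuous_intros continuous_map_closed_disc_coord) auto
  have w: "continuous_map (closed_disc p) euclideanreal (\<lambda>x. disc_weight p x i)" for i
    unfolding disc_weight_def
    by (cases "i \<le> p")
      (auto intro!: continuous_intros continuous_map_closed_disc_coord h continuous_map_min_coord)
  have "continuous_map (closed_disc p) euclideanreal (\<lambda>x. disc_to_simplex p x i)" for i
    unfolding disc_to_simplex_def
    by (intro continuous_map_real_divide continuous_map_sum w) (auto dest: sum_disc_weight_pos)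
  then show ?thesis
    using disc_to_simplex_in_standard_simplex
    by (auto simp: continuous_map_in_subtopology continuous_map_componentwise_UNIV)
qed

lemma min_coord_open_simplex_pos:
  assumes "y \<in> open_simplex p"
  shows "0 < min_coord p y"
proof -
  obtain i where "i \<le> p" "y i = min_coord p y"
    by (rule min_coord_attained)
  then show ?thesis
    using assms by (auto simp: open_simplex_def)
qed

lemma simplex_scale_pos:
  assumes "y \<in> open_simplex p"
  shows "0 < simplex_scale p y"
proof -
  have "0 < (\<Sum>i<p. (y i - y p) ^ 2) + min_coord p y ^ 2"
    using min_coord_open_simplex_pos[OF assms] by (intro add_nonneg_pos sum_nonneg) auto
  then show ?thesis
    by (simp add: simplex_scale_def)
qed

lemma simplex_scale_square:
  "simplex_scale p y ^ 2 = (\<Sum>i<p. (y i - y p) ^ 2) + min_coord p y ^ 2"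
  unfolding simplex_scale_def by (intro real_sqrt_pow2 add_nonneg_nonneg sum_nonneg) auto

lemma sum_simplex_to_disc_squares:
  assumes "y \<in> open_simplex p"
  shows "(\<Sum>i<p. simplex_to_disc p y i ^ 2) = 1 - (min_coord p y / simplex_scale p y) ^ 2"
proof -
  have "(\<Sum>i<p. simplex_to_disc p y i ^ 2) = (\<Sum>i<p. (y i - y p) ^ 2) / simplex_scale p y ^ 2"
    by (simp add: simplex_to_disc_def power_divide sum_divide_distrib)
  also have "(\<Sum>i<p. (y i - y p) ^ 2) = simplex_scale p y ^ 2 - min_coord p y ^ 2"
    by (simp add: simplex_scale_square)
  finally show ?thesis
    using simplex_scale_pos[OF assms] by (simp add: diff_divide_distrib power_divide)
qed

lemma simplex_to_disc_in_open_disc: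
  assumes "y \<in> open_simplex p"
  shows "simplex_to_disc p y \<in> topspace (open_disc p)"
  using sum_simplex_to_disc_squares[OF assms] simplex_scale_pos[OF assms] min_coord_open_simplex_pos[OF assms]
  by (simp add: topspace_open_disc simplex_to_disc_def[of p y])

lemma disc_to_simplex_simplex_to_disc:
  assumes y: "y \<in> open_simplex p"
  shows "disc_to_simplex p (simplex_to_disc p y) = y"
proof -
  let ?x = "simplex_to_disc p y" and ?c = "simplex_scale p y" and ?\<mu> = "min_coord p y"
  have c: "0 < ?c"
    using y by (rule simplex_scale_pos)
  have x: "?x i = (y i - y p) / ?c" if "i \<le> p" for i
    using that by (auto simp: simplex_to_disc_def)
  have height: "disc_height p ?x = ?\<mu> / ?c"
    using c min_coord_open_simplex_pos[OF y]
    by (simp add: disc_height_def sum_simplex_to_disc_squares[OF y] real_sqrt_unique)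
  have min: "min_coord p ?x = (?\<mu> - y p) / ?c"
  proof -
    obtain j where "j \<le> p" "y j = ?\<mu>"
      by (rule min_coord_attained)
    then show ?thesis
      using c by (intro min_coord_eqI[of j]) (auto simp: x divide_right_mono min_coord_le)
  qed
  have w: "disc_weight p ?x i = y i / ?c" for i
    using y c
    by (auto simp: disc_weight_def x height min open_simplex_def standard_simplex_def diff_divide_distrib)
  have "(\<Sum>i\<le>p. disc_weight p ?x i) = 1 / ?c"
    using y by (simp add: w open_simplex_def standard_simplex_def flip: sum_divide_distrib)
  then show ?thesis
    using c by (auto simp: disc_to_simplex_def w)
qed

lemma simplex_to_disc_disc_to_simplex:
  assumes x: "x \<in> topspace (open_disc p)"
  shows "simplex_to_disc p (disc_to_simplex p x) = x"
proof -
  have x': "x \<in> topspace (closed_disc p)"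
    using x by (auto simp: topspace_open_disc topspace_closed_disc)
  let ?y = "disc_to_simplex p x" and ?S = "\<Sum>j\<le>p. disc_weight p x j"
  have S: "0 < ?S"
    using x' by (rule sum_disc_weight_pos)
  have xp: "x i = 0" if "i \<ge> p" for i
    using x that by (simp add: topspace_open_disc)
  have y: "?y i = (x i - min_coord p x + disc_height p x) / ?S" if "i \<le> p" for i
    using that by (simp add: disc_to_simplex_def disc_weight_def)
  have diff: "?y i - ?y p = x i / ?S" if "i \<le> p" for i
    using that by (simp add: y xp diff_divide_distrib[symmetric])
  have min: "min_coord p ?y = disc_height p x / ?S"
  proof -
    obtain j where "j \<le> p" "x j = min_coord p x"
      by (rule min_coord_attained)
    then show ?thesis
      using S by (intro min_coord_eqI[of j]) (auto simp: y divide_right_mono min_coord_le)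
  qed
  have "simplex_scale p ?y = sqrt (((\<Sum>i<p. x i ^ 2) + disc_height p x ^ 2) / ?S ^ 2)"
    by (simp add: simplex_scale_def diff min power_divide add_divide_distrib sum_divide_distrib)
  also have "(\<Sum>i<p. x i ^ 2) + disc_height p x ^ 2 = 1"
    using x by (simp add: disc_height_def topspace_open_disc)
  finally have "simplex_scale p ?y = 1 / ?S"
    using S by (simp add: real_sqrt_divide)
  then show ?thesis
    using S by (auto simp: simplex_to_disc_def diff xp)
qed

lemma homeomorphic_map_disc_to_simplex:
  "homeomorphic_map (open_disc p) (subtopology (powertop_real UNIV) (open_simplex p)) (disc_to_simplex p)"
proof -
  let ?D = "subtopology (powertop_real UNIV) (open_simplex p)"
  have coord: "continuous_map ?D euclideanreal (\<lambda>y. y i)" for i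
    by (intro continuous_map_from_subtopology continuous_map_product_projection) simp
  have scale: "continuous_map ?D euclideanreal (simplex_scale p)"
    unfolding simplex_scale_def
    by (intro continuous_intros coord continuous_map_min_coord) auto
  have "continuous_map ?D euclideanreal (\<lambda>y. simplex_to_disc p y i)" for i
    unfolding simplex_to_disc_def
    by (cases "i < p")
      (auto intro!: continuous_map_real_divide continuous_map_diff coord scale
        simp: simplex_scale_pos less_imp_neq[OF simplex_scale_pos, symmetric])
  then have inv: "continuous_map ?D (open_disc p) (simplex_to_disc p)"
    using simplex_to_disc_in_open_disc[of _ p]
    unfolding open_disc_def Euclidean_space_def subtopology_subtopology
    by (auto simp: continuous_map_in_subtopology continuous_map_componentwise_UNIV topspace_open_disc)
  have sub: "x \<in> topspace (closed_disc p)" if "x \<in> topspace (open_disc p)" for x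
    using that by (auto simp: topspace_open_disc topspace_closed_disc)
  have "continuous_map (open_disc p) (simplex_topology p) (disc_to_simplex p)"
    by (subst open_disc_subtopology) (intro continuous_map_from_subtopology continuous_map_disc_to_simplex)
  then have "continuous_map (open_disc p) ?D (disc_to_simplex p)"
    using disc_to_simplex_in_open_simplex_iff[OF sub]
    by (auto simp: continuous_map_in_subtopology)
  with inv show ?thesis
    unfolding homeomorphic_map_maps homeomorphic_maps_def
    by (intro exI[of _ "simplex_to_disc p"])
      (simp add: simplex_to_disc_disc_to_simplex disc_to_simplex_simplex_to_disc)
qed

section \<open>The realization of the singular set of a space\<close>

text \<open>
  The image of the point \<open>x\<close> of the parameter simplex of \<open>s\<close> in the realization: a vanishing
  coordinate is deleted while \<open>s\<close> is replaced by the corresponding face, until the point is interior.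
\<close>

primrec normal_form :: "nat \<Rightarrow> ((nat \<Rightarrow> real) \<Rightarrow> 'a) \<Rightarrow> (nat \<Rightarrow> real) \<Rightarrow> 'a test_point"
  where
    "normal_form 0 s x = (s, x)"
  | "normal_form (Suc p) s x =
      (if \<forall>i\<le>Suc p. x i \<noteq> 0 then (s, x)
       else let k = LEAST i. x i = 0 in normal_form p (singular_face (Suc p) k s) (delete_coord k x))"

lemma normal_form_open_simplex: "x \<in> open_simplex p \<Longrightarrow> normal_form p s x = (s, x)"
  by (cases p) (auto simp: open_simplex_def)

text \<open>
  The order of deletion is immaterial: by the simplicial identities, deleting the \<open>k\<close>-th and the first
  vanishing coordinate in either order gives the same face and the same point.
  This says that the maps \<open>normal_form p s\<close> are compatible with the gluing along faces.
\<close>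

lemma normal_form_singular_face:
  assumes "x \<in> standard_simplex (Suc p)" "k \<le> Suc p" "x k = 0"
  shows "normal_form (Suc p) s x = normal_form p (singular_face (Suc p) k s) (delete_coord k x)"
  using assms
proof (induction p arbitrary: s x k)
  case 0
  then have "x 0 + x 1 = 1"
    by (simp add: standard_simplex_def)
  with 0 have "(LEAST i. x i = 0) = k"
    by (intro Least_equality) (auto simp: le_Suc_eq, metis One_nat_def Suc_leI add_0 less_one linorder_not_le not_gr0 zero_neq_one)
  with 0 show ?case by auto
next
  case (Suc p)
  \<comment> \<open>The coordinate that the recursion deletes first.\<close>
  define l where "l = (LEAST i. x i = 0)"
  have l: "x l = 0" "l \<le> k"
    using Suc.prems(3) by (auto simp: l_def intro: LeastI Least_le)
  have first: "normal_form (Suc (Suc p)) s x =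
      normal_form (Suc p) (singular_face (Suc (Suc p)) l s) (delete_coord l x)"
    using Suc.prems(2,3) unfolding normal_form.simps(2)[of "Suc p"] l_def Let_def by auto
  show ?case
  proof (cases "l = k")
    case False
    then obtain j where j: "k = Suc j" "l \<le> j" "j \<le> Suc p"
      using l(2) Suc.prems(2) by (cases k) auto
    have "normal_form (Suc p) (singular_face (Suc (Suc p)) l s) (delete_coord l x) =
        normal_form p (singular_face (Suc p) j (singular_face (Suc (Suc p)) l s))
          (delete_coord j (delete_coord l x))"
      using Suc.prems l j
      by (intro Suc.IH delete_coord_in_standard_simplex) (auto simp: delete_coord_def)
    moreover have "normal_form (Suc p) (singular_face (Suc (Suc p)) k s) (delete_coord k x) =
        normal_form p (singular_face (Suc p) l (singular_face (Suc (Suc p)) k s))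
          (delete_coord l (delete_coord k x))"
      using Suc.prems l j
      by (intro Suc.IH delete_coord_in_standard_simplex) (auto simp: delete_coord_def)
    ultimately show ?thesis
      using first j by (simp add: singular_face_singular_face delete_coord_delete_coord del: normal_form.simps)
  qed (use first in simp)
qed

lemma boundary_coord:
  assumes "x \<in> standard_simplex p - open_simplex p"
  obtains q k where "p = Suc q" "k \<le> Suc q" "x k = 0"
proof -
  obtain k where k: "k \<le> p" "x k = 0"
    using assms open_simplexI by blast
  moreover have "p \<noteq> 0"
  proof
    assume "p = 0"
    with k assms show False by (simp add: standard_simplex_def)
  qed
  ultimately show thesis
    using that by (cases p) auto
qed

text \<open>
  Properties of the gluing maps are proved for interior points and carried over from faces.
\<close>

lemma normal_form_induct [consumes 1, case_names interior face]:
  assumes "x \<in> standard_simplex p"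
    and "\<And>p s x. x \<in> open_simplex p \<Longrightarrow> Q p s x"
    and "\<And>p k s x. \<lbrakk>x \<in> standard_simplex (Suc p); k \<le> Suc p; x k = 0;
        delete_coord k x \<in> standard_simplex p;
        normal_form (Suc p) s x = normal_form p (singular_face (Suc p) k s) (delete_coord k x);
        Q p (singular_face (Suc p) k s) (delete_coord k x)\<rbrakk> \<Longrightarrow> Q (Suc p) s x"
  shows "Q p s x"
  using assms(1)
proof (induction p arbitrary: s x)
  case 0
  then have "x \<in> open_simplex 0"
    using boundary_coord by blast
  then show ?case by (rule assms(2))
next
  case (Suc p)
  show ?case
  proof (cases "x \<in> open_simplex (Suc p)")
    case False
    then obtain k where "k \<le> Suc p" "x k = 0"
      using boundary_coord Suc.prems by blast
    with Suc show ?thesis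
      by (intro assms(3) normal_form_singular_face delete_coord_in_standard_simplex Suc.IH) auto
  qed (rule assms(2))
qed

definition realization_points :: "nat \<Rightarrow> 'a topology \<Rightarrow> 'a test_point set"
  where "realization_points m X = {(s, x). \<exists>p\<le>m. singular_simplex p X s \<and> x \<in> open_simplex p}"

text \<open>
  The final topology for the maps \<open>normal_form p s\<close>.
\<close>

definition realization :: "nat \<Rightarrow> 'a topology \<Rightarrow> 'a test_point topology"
  where "realization m X = topology (\<lambda>V. V \<subseteq> realization_points m X \<and>
    (\<forall>p\<le>m. \<forall>s. singular_simplex p X s \<longrightarrow>
      openin (simplex_topology p) {x \<in> standard_simplex p. normal_form p s x \<in> V}))"

lemma openin_realization:
  "openin (realization m X) V \<longleftrightarrow> V \<subseteq> realization_points m X \<and>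
    (\<forall>p\<le>m. \<forall>s. singular_simplex p X s \<longrightarrow>
      openin (simplex_topology p) {x \<in> standard_simplex p. normal_form p s x \<in> V})"
proof -
  let ?Q = "\<lambda>V. V \<subseteq> realization_points m X \<and> (\<forall>p\<le>m. \<forall>s. singular_simplex p X s \<longrightarrow>
      openin (simplex_topology p) {x \<in> standard_simplex p. normal_form p s x \<in> V})"
  have "istopology ?Q"
    unfolding istopology_def
  proof (intro conjI allI impI)
    fix S T p s
    assume "?Q S" "?Q T" "p \<le> m" "singular_simplex p X s"
    then have "openin (simplex_topology p)
        ({x \<in> standard_simplex p. normal_form p s x \<in> S} \<inter> {x \<in> standard_simplex p. normal_form p s x \<in> T})"
      by (intro openin_Int) auto
    moreover have "{x \<in> standard_simplex p. normal_form p s x \<in> S \<inter> T} =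
        {x \<in> standard_simplex p. normal_form p s x \<in> S} \<inter> {x \<in> standard_simplex p. normal_form p s x \<in> T}"
      by auto
    ultimately show "openin (simplex_topology p) {x \<in> standard_simplex p. normal_form p s x \<in> S \<inter> T}"
      by simp
  next
    fix K p s
    assume K: "\<forall>S\<in>K. ?Q S" "p \<le> m" "singular_simplex p X s"
    have "{x \<in> standard_simplex p. normal_form p s x \<in> \<Union>K} =
        (\<Union>S\<in>K. {x \<in> standard_simplex p. normal_form p s x \<in> S})"
      by auto
    with K show "openin (simplex_topology p) {x \<in> standard_simplex p. normal_form p s x \<in> \<Union>K}"
      by (auto intro!: openin_Union)
  qed auto
  then show ?thesis
    unfolding realization_def by simp
qed

lemma normal_form_in_realization_points:
  assumes "x \<in> standard_simplex p" "p \<le> m" "singular_simplex p X s"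
  shows "normal_form p s x \<in> realization_points m X"
  using assms
proof (induction p s x rule: normal_form_induct)
  case (interior p s x)
  then show ?case by (auto simp: realization_points_def normal_form_open_simplex)
next
  case (face p k s x)
  then show ?case
    using singular_simplex_singular_face[of "Suc p" X s k] by simp
qed

lemma topspace_realization [simp]: "topspace (realization m X) = realization_points m X"
proof
  show "topspace (realization m X) \<subseteq> realization_points m X"
    using openin_realization openin_topspace by blast
  have "{x \<in> standard_simplex p. normal_form p s x \<in> realization_points m X} = standard_simplex p"
    if "p \<le> m" "singular_simplex p X s" for p s
    using normal_form_in_realization_points[OF _ that] by auto
  then have "openin (realization m X) (realization_points m X)"
    by (simp add: openin_realization) (metis openin_topspace topspace_standard_simplex)
  then show "realization_points m X \<subseteq> topspace (realization m X)"
    by (rule openin_subset)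
qed

lemma continuous_map_normal_form:
  assumes "p \<le> m" "singular_simplex p X s"
  shows "continuous_map (simplex_topology p) (realization m X) (normal_form p s)"
  using assms normal_form_in_realization_points[OF _ assms]
  by (auto simp: continuous_map_def openin_realization)

lemma continuous_map_realization:
  assumes "\<And>p s. p \<le> m \<Longrightarrow> singular_simplex p X s \<Longrightarrow>
      continuous_map (simplex_topology p) Z (\<lambda>x. g (normal_form p s x))"
  shows "continuous_map (realization m X) Z g"
  unfolding continuous_map_def
proof (intro conjI allI impI)
  show "g \<in> topspace (realization m X) \<rightarrow> topspace Z"
  proof
    fix a
    assume "a \<in> topspace (realization m X)"
    then obtain p s x where a: "a = (s, x)" "p \<le> m" "singular_simplex p X s" "x \<in> open_simplex p"
      by (auto simp: realization_points_def)
    then have "x \<in> topspace (simplex_topology p)"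
      using open_simplex_subset by auto
    then have "g (normal_form p s x) \<in> topspace Z"
      using assms[OF a(2,3)] by (auto simp: continuous_map_def)
    then show "g a \<in> topspace Z"
      using a by (simp add: normal_form_open_simplex)
  qed
  fix V
  assume V: "openin Z V"
  show "openin (realization m X) {a \<in> topspace (realization m X). g a \<in> V}"
    unfolding openin_realization
  proof (intro conjI allI impI)
    fix p s
    assume ps: "p \<le> m" "singular_simplex p X s"
    have "{x \<in> standard_simplex p. normal_form p s x \<in> {a \<in> topspace (realization m X). g a \<in> V}} =
        {x \<in> topspace (simplex_topology p). g (normal_form p s x) \<in> V}"
      using normal_form_in_realization_points[OF _ ps] by auto
    then show "openin (simplex_topology p)
        {x \<in> standard_simplex p. normal_form p s x \<in> {a \<in> topspace (realization m X). g a \<in> V}}"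
      using openin_continuous_map_preimage[OF assms[OF ps] V] by simp
  qed auto
qed

definition evaluation :: "'a test_point \<Rightarrow> 'a"
  where "evaluation = (\<lambda>(s, x). s x)"

lemma evaluation_normal_form: "x \<in> standard_simplex p \<Longrightarrow> evaluation (normal_form p s x) = s x"
proof (induction p s x rule: normal_form_induct)
  case (interior p s x)
  then show ?case by (simp add: evaluation_def normal_form_open_simplex)
next
  case (face p k s x)
  then have "singular_face (Suc p) k s (delete_coord k x) = s x"
    by (simp add: singular_face_def simplical_face_delete_coord)
  with face show ?case by (simp del: normal_form.simps)
qed

lemma continuous_map_evaluation: "continuous_map (realization m X) X evaluation"
  by (rule continuous_map_realization, rule continuous_map_eq)
    (auto simp: singular_simplex_def evaluation_normal_form)

section \<open>Continuous functions on the realization\<close>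

text \<open>
  Let \<open>F\<close> be a function of barycentric coordinates, zero as soon as one of the first \<open>q + 1\<close> of
  them is, and regard it as given on the cell of a \<open>q\<close>-simplex \<open>t\<close>.  To extend it continuously over
  the realization, a value is needed at a point \<open>x\<close> of any \<open>p\<close>-simplex \<open>s\<close>.
  The value is the sum of \<open>F\<close>, applied to the coordinates of \<open>x\<close> at the vertices of \<open>\<sigma>\<close>, over all
  \<open>q\<close>-dimensional faces \<open>\<sigma>\<close> of the parameter simplex on which \<open>s\<close> restricts to \<open>t\<close>.
  The sum over the faces of codimension \<open>p - q\<close> is written recursively over the facets: each
  such face lies in \<open>p - q\<close> facets, whence the division.
\<close>

primrec bump :: "nat \<Rightarrow> ((nat \<Rightarrow> real) \<Rightarrow> 'a) \<Rightarrow> ((nat \<Rightarrow> real) \<Rightarrow> real) \<Rightarrow> nat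
    \<Rightarrow> ((nat \<Rightarrow> real) \<Rightarrow> 'a) \<Rightarrow> (nat \<Rightarrow> real) \<Rightarrow> real"
  where
    "bump q t F 0 s x = (if q = 0 \<and> s = t then F x else 0)"
  | "bump q t F (Suc p) s x =
      (if q = Suc p then if s = t then F x else 0
       else (\<Sum>k\<le>Suc p. bump q t F p (singular_face (Suc p) k s) (delete_coord k x)) /
         (real (Suc p) - real q))"

lemma bump_same_dim: "bump q t F q s x = (if s = t then F x else 0)"
  by (cases q) auto

lemma bump_lower_dim: "p < q \<Longrightarrow> bump q t F p s x = 0"
  by (induction p arbitrary: s x) auto

text \<open>
  A facet other than the \<open>j\<close>-th contributes \<open>F\<close> at a point that still has a zero
  coordinate, so only the \<open>j\<close>-th one counts.
\<close>

lemma bump_singular_face_same_dim: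
  assumes F: "\<And>z i. i \<le> q \<Longrightarrow> z i = 0 \<Longrightarrow> F z = 0"
    and j: "j \<le> Suc q" "x j = 0"
  shows "bump q t F (Suc q) s x = bump q t F q (singular_face (Suc q) j s) (delete_coord j x)"
proof -
  define G where "G k = bump q t F q (singular_face (Suc q) k s) (delete_coord k x)" for k
  have "delete_coord j G k = 0" if "k \<le> q" for k
  proof -
    let ?z = "delete_coord (if k < j then k else Suc k) x"
    have "?z (if k < j then j - 1 else j) = 0"
      using j by (auto simp: delete_coord_def)
    then have "F ?z = 0"
      by (rule F[rotated]) (use that j in auto)
    then show ?thesis
      by (cases "k < j") (simp_all add: G_def bump_same_dim delete_coord_def[of j G])
  qed
  then have "(\<Sum>k\<le>q. delete_coord j G k) = 0"
    by simp
  then have "(\<Sum>k\<le>Suc q. G k) = G j"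
    using sum_delete_coord[of j q G] j by simp
  then show ?thesis
    by (simp add: G_def)
qed

text \<open>
  On a face of the parameter simplex, faces that are not contained in it
  contribute zero because \<open>F\<close> vanishes when a coordinate does; the others are the faces of the face.
  Therefore the functions \<open>bump q t F p s\<close> fit together to one function on the realization.
\<close>

lemma bump_singular_face:
  assumes F: "\<And>z i. i \<le> q \<Longrightarrow> z i = 0 \<Longrightarrow> F z = 0"
    and "j \<le> Suc p" "x j = 0"
  shows "bump q t F (Suc p) s x = bump q t F p (singular_face (Suc p) j s) (delete_coord j x)"
  using assms(2,3)
proof (induction p arbitrary: s x j)
  case 0
  consider "q = 0" | "q = Suc 0" | "Suc 0 < q" by linarith
  then show ?case
  proof cases
    case 1
    with 0 show ?thesis
      using bump_singular_face_same_dim[of q F j x t s] F by blast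
  next
    case 2
    with 0 show ?thesis by (auto intro: F[of j])
  qed (simp add: bump_lower_dim)
next
  case (Suc p)
  define G where "G k = bump q t F (Suc p) (singular_face (Suc (Suc p)) k s) (delete_coord k x)" for k
  let ?sj = "singular_face (Suc (Suc p)) j s" and ?xj = "delete_coord j x"
  consider "q > Suc (Suc p)" | "q = Suc (Suc p)" | "q = Suc p" | "q \<le> p" by linarith
  then show ?case
  proof cases
    case 2
    with Suc.prems show ?thesis
      by (auto simp: bump_lower_dim intro: F[of j])
  next
    case 3
    with Suc.prems show ?thesis
      using bump_singular_face_same_dim[of q F j x t s] F by blast
  next
    case 4
    \<comment> \<open>By induction every facet but the \<open>j\<close>-th may be replaced by its intersection with the \<open>j\<close>-th.\<close>
    have "delete_coord j G k = bump q t F p (singular_face (Suc p) k ?sj) (delete_coord k ?xj)"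
      if "k \<le> Suc p" for k
    proof (cases "k < j")
      case True
      then obtain i where i: "j = Suc i" "k \<le> i" "i \<le> Suc p"
        using Suc.prems by (cases j) auto
      have "delete_coord j G k = G k"
        using True by (simp add: delete_coord_def)
      also have "\<dots> = bump q t F p (singular_face (Suc p) i (singular_face (Suc (Suc p)) k s))
          (delete_coord i (delete_coord k x))"
        unfolding G_def using i Suc.prems by (intro Suc.IH) (auto simp: delete_coord_def)
      finally show ?thesis
        using i by (simp add: singular_face_singular_face delete_coord_delete_coord)
    next
      case False
      then have "delete_coord j G k = G (Suc k)"
        by (simp add: delete_coord_def)
      also have "\<dots> = bump q t F p (singular_face (Suc p) j (singular_face (Suc (Suc p)) (Suc k) s))
          (delete_coord j (delete_coord (Suc k) x))"
        unfolding G_def using False that Suc.prems by (intro Suc.IH) (auto simp: delete_coord_def)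
      finally show ?thesis
        using False that by (simp add: singular_face_singular_face delete_coord_delete_coord)
    qed
    then have "(\<Sum>k\<le>Suc p. delete_coord j G k) =
        (\<Sum>k\<le>Suc p. bump q t F p (singular_face (Suc p) k ?sj) (delete_coord k ?xj))"
      by (intro sum.cong) auto
    also have "\<dots> = (real (Suc p) - real q) * G j"
      using 4 by (simp add: G_def del: sum.atMost_Suc)
    \<comment> \<open>The \<open>j\<close>-th facet itself completes the factor to the one that the definition divides by.\<close>
    finally have "(\<Sum>k\<le>Suc (Suc p). G k) = (real (Suc (Suc p)) - real q) * G j"
      using sum_delete_coord[of j "Suc p" G] Suc.prems by (simp add: algebra_simps del: sum.atMost_Suc)
    then show ?thesis
      using 4 unfolding bump.simps(2)[of q t F "Suc p"] G_def by (simp del: sum.atMost_Suc)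
  qed (simp add: bump_lower_dim del: bump.simps)
qed

lemma continuous_map_bump:
  assumes F: "continuous_map (powertop_real UNIV) euclideanreal F"
  shows "continuous_map (powertop_real UNIV) euclideanreal (bump q t F p s)"
proof (induction p arbitrary: s)
  case 0
  show ?case
  proof -
    have "bump q t F 0 s = (if q = 0 \<and> s = t then F else (\<lambda>x. 0))"
      by auto
    then show ?thesis
      using F by simp
  qed
next
  case (Suc p)
  have "continuous_map (powertop_real UNIV) euclideanreal
      (\<lambda>x. bump q t F p (singular_face (Suc p) k s) (delete_coord k x))" for k
    using continuous_map_compose[OF continuous_map_delete_coord Suc] by (simp add: o_def)
  then show ?case
    using F by (cases "q = Suc p"; cases "s = t")
      (auto intro!: continuous_map_real_divide continuous_map_sum simp del: sum.atMost_Suc)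
qed

text \<open>
  The points of the realization do not record the dimension of their cell; it can be recovered from
  the second component, but not from the first, as one function may be a singular simplex in
  several dimensions.
\<close>

definition point_dim :: "(nat \<Rightarrow> real) \<Rightarrow> nat"
  where "point_dim x = (THE p. x \<in> open_simplex p)"

lemma point_dim_eq: "x \<in> open_simplex p \<Longrightarrow> point_dim x = p"
  unfolding point_dim_def by (rule the_equality) (auto dest: open_simplex_dim_unique)

text \<open>
  The \<open>j\<close>-th barycentric coordinate, damped by a factor that vanishes on the boundary.  As the barycentric
  coordinates add up to 1, the factor is recovered as the sum over \<open>j\<close>.
\<close>

definition vertex_weight :: "nat \<Rightarrow> nat \<Rightarrow> (nat \<Rightarrow> real) \<Rightarrow> real"
  where "vertex_weight q j z = (\<Prod>i\<le>q. z i) * z j"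

definition cell_coord :: "nat \<Rightarrow> ((nat \<Rightarrow> real) \<Rightarrow> 'a) \<Rightarrow> nat \<Rightarrow> 'a test_point \<Rightarrow> real"
  where "cell_coord q t j = (\<lambda>(s, x). bump q t (vertex_weight q j) (point_dim x) s x)"

lemma cell_coord_normal_form:
  "x \<in> standard_simplex p \<Longrightarrow> cell_coord q t j (normal_form p s x) = bump q t (vertex_weight q j) p s x"
proof (induction p s x rule: normal_form_induct)
  case (interior p s x)
  then show ?case by (simp add: cell_coord_def normal_form_open_simplex point_dim_eq)
next
  case (face p k s x)
  have "vertex_weight q j z = 0" if "i \<le> q" "z i = 0" for z i
    using that by (auto simp: vertex_weight_def)
  with face show ?case
    by (simp add: bump_singular_face[of q "vertex_weight q j" k p x t s] del: bump.simps)
qed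

lemma continuous_map_cell_coord: "continuous_map (realization m X) euclideanreal (cell_coord q t j)"
proof (rule continuous_map_realization)
  fix p and s :: "(nat \<Rightarrow> real) \<Rightarrow> 'a"
  have "continuous_map (powertop_real UNIV) euclideanreal (vertex_weight q j)"
    unfolding vertex_weight_def
    by (auto intro!: continuous_map_real_mult continuous_map_prod continuous_map_product_projection)
  then have "continuous_map (simplex_topology p) euclideanreal (bump q t (vertex_weight q j) p s)"
    by (intro continuous_map_from_subtopology continuous_map_bump)
  then show "continuous_map (simplex_topology p) euclideanreal (\<lambda>x. cell_coord q t j (normal_form p s x))"
    by (rule continuous_map_eq) (simp add: cell_coord_normal_form)
qed

lemma cell_coord_le:
  assumes "x \<in> open_simplex p" "p \<le> q"
  shows "cell_coord q t j (s, x) = (if p = q \<and> s = t then vertex_weight q j x else 0)"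
  using assms by (auto simp: cell_coord_def point_dim_eq bump_same_dim bump_lower_dim order_le_less)

lemma sum_vertex_weight:
  "x \<in> standard_simplex q \<Longrightarrow> (\<Sum>j\<le>q. vertex_weight q j x) = (\<Prod>i\<le>q. x i)"
  by (simp add: vertex_weight_def standard_simplex_def flip: sum_distrib_left)

lemma prod_open_simplex_pos: "x \<in> open_simplex q \<Longrightarrow> 0 < (\<Prod>i\<le>q. x i)"
  by (auto simp: open_simplex_def intro!: prod_pos)

lemma vertex_weight_inj:
  assumes x: "x \<in> open_simplex q" and y: "y \<in> open_simplex q"
    and eq: "\<And>j. j \<le> q \<Longrightarrow> vertex_weight q j x = vertex_weight q j y"
  shows "x = y"
proof
  fix i
  have "(\<Prod>i\<le>q. x i) = (\<Prod>i\<le>q. y i)"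
    using x y open_simplex_subset[of q] eq by (subst (1 2) sum_vertex_weight[symmetric]) auto
  then show "x i = y i"
    using eq[of i] prod_open_simplex_pos[OF y] x y
    by (cases "i \<le> q") (auto simp: vertex_weight_def open_simplex_def standard_simplex_def)
qed

text \<open>
  For two points in different cells, the functions belonging to the cell of larger (or equal)
  dimension are zero at the other point; two points of the same cell have different coordinates.
\<close>

lemma cell_coord_separates:
  assumes "a \<in> realization_points m X" "b \<in> realization_points m X" "a \<noteq> b"
  obtains q t j where "cell_coord q t j a \<noteq> cell_coord q t j b"
proof -
  have *: "\<exists>q t j. cell_coord q t j (s, x) \<noteq> cell_coord q t j (s', x')"
    if x: "x \<in> open_simplex q" and x': "x' \<in> open_simplex p" and "p \<le> q" and ne: "(s, x) \<noteq> (s', x')"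
    for q p x x' and s s' :: "(nat \<Rightarrow> real) \<Rightarrow> 'a"
  proof (rule ccontr)
    assume "\<not> ?thesis"
    then have eq: "cell_coord q s j (s, x) = cell_coord q s j (s', x')" for j
      by blast
    have pos: "0 < vertex_weight q 0 x"
      using prod_open_simplex_pos[OF x] x by (simp add: vertex_weight_def open_simplex_def)
    have eq: "vertex_weight q j x = (if p = q \<and> s' = s then vertex_weight q j x' else 0)" for j
      using eq[of j] by (simp add: cell_coord_le[OF x] cell_coord_le[OF x' \<open>p \<le> q\<close>])
    then have "p = q" "s' = s"
      using pos eq[of 0] by (auto split: if_splits)
    moreover have "x = x'"
      using x x' eq \<open>p = q\<close> \<open>s' = s\<close> by (intro vertex_weight_inj) auto
    ultimately show False
      using ne by simp
  qed
  obtain s x q where "a = (s, x)" "x \<in> open_simplex q"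
    using assms(1) unfolding realization_points_def by blast
  moreover obtain s' x' p where "b = (s', x')" "x' \<in> open_simplex p"
    using assms(2) unfolding realization_points_def by blast
  ultimately show thesis
    using *[of x q x' p s s'] *[of x' p x q s' s] assms(3) that by (metis nle_le)
qed

lemma Hausdorff_space_realization: "Hausdorff_space (realization m X)"
  unfolding Hausdorff_space_def
proof (intro allI impI, elim conjE)
  fix a b
  assume ab: "a \<in> topspace (realization m X)" "b \<in> topspace (realization m X)" "a \<noteq> b"
  then obtain q t j where ne: "cell_coord q t j a \<noteq> cell_coord q t j b"
    using cell_coord_separates[of a m X b] by auto
  obtain S T where ST: "open S" "open T" "cell_coord q t j a \<in> S" "cell_coord q t j b \<in> T" "S \<inter> T = {}"
    using hausdorff[OF ne] by blast
  let ?pre = "\<lambda>S. {a \<in> topspace (realization m X). cell_coord q t j a \<in> S}"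
  have "openin (realization m X) (?pre S)" "openin (realization m X) (?pre T)"
    using ST by (auto intro!: openin_continuous_map_preimage continuous_map_cell_coord simp del: topspace_realization)
  moreover have "a \<in> ?pre S" "b \<in> ?pre T" "disjnt (?pre S) (?pre T)"
    using ab ST by (auto simp: disjnt_def)
  ultimately show "\<exists>U V. openin (realization m X) U \<and> openin (realization m X) V \<and> a \<in> U \<and> b \<in> V \<and> disjnt U V"
    by blast
qed

section \<open>The cell structure\<close>

definition cell :: "nat \<Rightarrow> ((nat \<Rightarrow> real) \<Rightarrow> 'a) \<Rightarrow> 'a test_point set"
  where "cell p s = {s} \<times> open_simplex p"

lemma normal_form_onto_cell: "normal_form p s ` open_simplex p = cell p s"
  by (auto simp: cell_def normal_form_open_simplex image_iff)

lemma cell_eq_iff [simp]: "cell p s = cell q t \<longleftrightarrow> p = q \<and> s = t"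
proof
  assume "cell p s = cell q t"
  then have "(s, barycenter p) \<in> cell q t"
    using barycenter_in_open_simplex[of p] by (auto simp: cell_def)
  then show "p = q \<and> s = t"
    using barycenter_in_open_simplex[of p] by (auto simp: cell_def dest: open_simplex_dim_unique)
qed auto

lemma disjnt_cells: "(p, s) \<noteq> (q, t) \<Longrightarrow> disjnt (cell p s) (cell q t)"
  by (auto simp: disjnt_def cell_def dest: open_simplex_dim_unique)

definition cells :: "nat \<Rightarrow> 'a topology \<Rightarrow> 'a test_point set set"
  where "cells m X = {cell p s | p s. p \<le> m \<and> singular_simplex p X s}"

lemma Union_cells: "\<Union>(cells m X) = realization_points m X"
  by (auto simp: cells_def cell_def realization_points_def)

text \<open>
  The inverse is the second projection.  Its \<open>i\<close>-th component is the quotient of the globally continuous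
  functions \<open>cell_coord p s i\<close> and \<open>\<Sum>j\<le>p. cell_coord p s j\<close>, hence continuous.
\<close>

lemma homeomorphic_map_open_cell:
  assumes "p \<le> m" "singular_simplex p X s"
  shows "homeomorphic_map (subtopology (powertop_real UNIV) (open_simplex p))
    (subtopology (realization m X) (cell p s)) (normal_form p s)"
proof -
  let ?P = "subtopology (realization m X) (cell p s)"
  let ?D = "subtopology (powertop_real UNIV) (open_simplex p)"
  have "continuous_map (subtopology (simplex_topology p) (open_simplex p)) (realization m X) (normal_form p s)"
    by (intro continuous_map_from_subtopology continuous_map_normal_form assms)
  moreover have "subtopology (simplex_topology p) (open_simplex p) = ?D"
    using open_simplex_subset[of p] by (simp add: subtopology_subtopology Int_absorb1)
  ultimately have 1: "continuous_map ?D ?P (normal_form p s)"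
    using normal_form_onto_cell[of p s] by (auto simp: continuous_map_in_subtopology)
  have cellD: "snd a \<in> open_simplex p" "fst a = s" if "a \<in> topspace ?P" for a
    using that by (auto simp: cell_def)
  have coord: "cell_coord p s j a = (\<Prod>i\<le>p. snd a i) * snd a j" if "a \<in> topspace ?P" for a j
    using cell_coord_le[OF cellD(1)[OF that], of p s j s] cellD[OF that]
    by (cases a) (simp add: vertex_weight_def)
  have sum_coord: "(\<Sum>j\<le>p. cell_coord p s j a) = (\<Prod>i\<le>p. snd a i)" if "a \<in> topspace ?P" for a
    using cellD(1)[OF that]
    by (simp add: coord[OF that] open_simplex_def standard_simplex_def flip: sum_distrib_left)
  have cont: "continuous_map ?P euclideanreal (cell_coord p s j)" for j
    by (intro continuous_map_from_subtopology continuous_map_cell_coord)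
  have "continuous_map ?P euclideanreal (\<lambda>a. snd a i)" for i
  proof (rule continuous_map_eq)
    have "(\<Sum>j\<le>p. cell_coord p s j a) \<noteq> 0" if "a \<in> topspace ?P" for a
      unfolding sum_coord[OF that]
      by (rule less_imp_neq[OF prod_open_simplex_pos[OF cellD(1)[OF that]], symmetric])
    then show "continuous_map ?P euclideanreal (\<lambda>a. cell_coord p s i a / (\<Sum>j\<le>p. cell_coord p s j a))"
      by (intro continuous_map_real_divide continuous_map_sum cont) auto
    show "cell_coord p s i a / (\<Sum>j\<le>p. cell_coord p s j a) = snd a i" if "a \<in> topspace ?P" for a
      unfolding sum_coord[OF that] unfolding coord[OF that]
      by (rule nonzero_mult_div_cancel_left[OF less_imp_neq[OF prod_open_simplex_pos[OF cellD(1)[OF that]], symmetric]])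
  qed
  then have 2: "continuous_map ?P ?D snd"
    using cellD by (auto simp: continuous_map_in_subtopology continuous_map_componentwise_UNIV)
  show ?thesis
    unfolding homeomorphic_map_maps homeomorphic_maps_def
  proof (intro exI conjI ballI)
    show "normal_form p s (snd a) = a" if "a \<in> topspace ?P" for a
      using cellD[OF that] by (cases a) (simp add: normal_form_open_simplex)
  qed (use 1 2 in \<open>auto simp: normal_form_open_simplex\<close>)
qed

text \<open>
  A boundary point lies on a facet, either in its interior or again on its boundary; so induction on
  the dimension yields finitely many cells.
\<close>

lemma normal_form_boundary:
  assumes "singular_simplex p X s"
  shows "\<exists>F. finite F \<and> F \<subseteq> {cell q t | q t. q < p \<and> singular_simplex q X t} \<and>
    normal_form p s ` (standard_simplex p - open_simplex p) \<subseteq> \<Union>F"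
  using assms
proof (induction p arbitrary: s)
  case 0
  show ?case
    using boundary_coord[of _ 0] by (intro exI[of _ "{}"]) auto
next
  case (Suc p)
  let ?f = "\<lambda>k. singular_face (Suc p) k s"
  have face: "singular_simplex p X (?f k)" if "k \<le> Suc p" for k
    using singular_simplex_singular_face[OF Suc.prems _ that] by simp
  then have "\<forall>k\<in>{..Suc p}. \<exists>F. finite F \<and> F \<subseteq> {cell q t | q t. q < p \<and> singular_simplex q X t} \<and>
      normal_form p (?f k) ` (standard_simplex p - open_simplex p) \<subseteq> \<Union>F"
    using Suc.IH by blast
  from bchoice[OF this] obtain F where
    "\<forall>k\<in>{..Suc p}. finite (F k) \<and> F k \<subseteq> {cell q t | q t. q < p \<and> singular_simplex q X t} \<and>
      normal_form p (?f k) ` (standard_simplex p - open_simplex p) \<subseteq> \<Union>(F k)" ..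
  then have F: "\<And>k. k \<le> Suc p \<Longrightarrow> finite (F k)"
    "\<And>k. k \<le> Suc p \<Longrightarrow> F k \<subseteq> {cell q t | q t. q < p \<and> singular_simplex q X t}"
    "\<And>k. k \<le> Suc p \<Longrightarrow> normal_form p (?f k) ` (standard_simplex p - open_simplex p) \<subseteq> \<Union>(F k)"
    by simp_all
  let ?F = "\<Union>k\<le>Suc p. insert (cell p (?f k)) (F k)"
  show ?case
  proof (intro exI[of _ ?F] conjI)
    show "finite ?F"
      using F(1) by auto
    show "?F \<subseteq> {cell q t | q t. q < Suc p \<and> singular_simplex q X t}"
    proof (intro UN_least insert_subsetI)
      fix k
      assume "k \<in> {..Suc p}"
      then have k: "k \<le> Suc p" by simp
      show "cell p (?f k) \<in> {cell q t | q t. q < Suc p \<and> singular_simplex q X t}"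
        using face[OF k] by blast
      show "F k \<subseteq> {cell q t | q t. q < Suc p \<and> singular_simplex q X t}"
        using F(2)[OF k] less_SucI by blast
    qed
    show "normal_form (Suc p) s ` (standard_simplex (Suc p) - open_simplex (Suc p)) \<subseteq> \<Union>?F"
    proof (rule image_subsetI)
      fix x
      assume "x \<in> standard_simplex (Suc p) - open_simplex (Suc p)"
      then have x: "x \<in> standard_simplex (Suc p)" "x \<notin> open_simplex (Suc p)"
        by auto
      then obtain k where k: "k \<le> Suc p" "x k = 0"
        using boundary_coord by blast
      let ?y = "delete_coord k x"
      have y: "?y \<in> standard_simplex p"
        using x k by (intro delete_coord_in_standard_simplex)
      have "normal_form p (?f k) ?y \<in> \<Union>(insert (cell p (?f k)) (F k))"
      proof (cases "?y \<in> open_simplex p")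
        case True
        then show ?thesis
          by (simp add: normal_form_open_simplex cell_def)
      next
        case False
        then show ?thesis
          using F(3)[OF k(1)] y by blast
      qed
      then show "normal_form (Suc p) s x \<in> \<Union>?F"
        unfolding normal_form_singular_face[OF x(1) k] using k(1) by (meson UN_I UnionE UnionI atMost_iff)
    qed
  qed
qed

definition cell_dim :: "'a test_point set \<Rightarrow> nat"
  where "cell_dim e = (THE p. \<exists>s. e = cell p s)"

definition cell_simplex :: "'a test_point set \<Rightarrow> (nat \<Rightarrow> real) \<Rightarrow> 'a"
  where "cell_simplex e = (THE s. \<exists>p. e = cell p s)"

lemma cell_dim_cell [simp]: "cell_dim (cell p s) = p"
  unfolding cell_dim_def by (rule the_equality) auto

lemma cell_simplex_cell [simp]: "cell_simplex (cell p s) = s"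
  unfolding cell_simplex_def by (rule the_equality) auto

text \<open>
  The closure of a cell contains the image of its whole parameter simplex, so the preimages of \<open>A\<close> and of
  its intersection with the closed cell agree, and the topology is final for these
  maps.
\<close>

lemma closedin_realization_weak:
  assumes A: "A \<subseteq> realization_points m X"
    and closed: "\<And>e. e \<in> cells m X \<Longrightarrow> closedin (realization m X) (A \<inter> realization m X closure_of e)"
  shows "closedin (realization m X) A"
proof -
  let ?P = "realization m X"
  have "openin ?P (realization_points m X - A)"
    unfolding openin_realization
  proof (intro conjI allI impI)
    fix p s
    assume ps: "p \<le> m" "singular_simplex p X s"
    let ?B = "A \<inter> ?P closure_of (cell p s)"
    have cont: "continuous_map (simplex_topology p) ?P (normal_form p s)"
      by (rule continuous_map_normal_form[OF ps])
    have "normal_form p s x \<in> ?P closure_of (cell p s)" if "x \<in> standard_simplex p" for x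
    proof -
      have "normal_form p s x \<in> normal_form p s ` (simplex_topology p closure_of open_simplex p)"
        by (rule imageI) (use standard_simplex_subset_closure that in blast)
      then show ?thesis
        using continuous_map_image_closure_subset[OF cont, of "open_simplex p"]
        unfolding normal_form_onto_cell by (rule rev_subsetD)
    qed
    then have eq: "{x \<in> standard_simplex p. normal_form p s x \<in> realization_points m X - A} =
        topspace (simplex_topology p) - {x \<in> topspace (simplex_topology p). normal_form p s x \<in> ?B}"
      using normal_form_in_realization_points[OF _ ps] unfolding topspace_standard_simplex by blast
    have "closedin ?P ?B"
      using ps by (intro closed) (unfold cells_def, blast)
    then have "closedin (simplex_topology p) {x \<in> topspace (simplex_topology p). normal_form p s x \<in> ?B}"
      by (rule closedin_continuous_map_preimage[OF cont])
    then show "openin (simplex_topology p)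
        {x \<in> standard_simplex p. normal_form p s x \<in> realization_points m X - A}"
      unfolding eq by (intro openin_diff openin_topspace)
  qed auto
  then show ?thesis
    using A by (simp add: closedin_def)
qed

lemma cw_decomposition_realization:
  "cw_decomposition (realization m X) (cells m X) cell_dim
    (\<lambda>e. normal_form (cell_dim e) (cell_simplex e) \<circ> disc_to_simplex (cell_dim e))"
  unfolding cw_decomposition_def
proof (intro conjI)
  show "Hausdorff_space (realization m X)"
    by (rule Hausdorff_space_realization)
  show "\<Union>(cells m X) = topspace (realization m X)"
    by (simp add: Union_cells)
  show "pairwise disjnt (cells m X)"
    by (auto simp: pairwise_def cells_def intro!: disjnt_cells)
  show "\<forall>e\<in>cells m X. continuous_map (closed_disc (cell_dim e)) (realization m X)
          (normal_form (cell_dim e) (cell_simplex e) \<circ> disc_to_simplex (cell_dim e)) \<and>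
      homeomorphic_map (open_disc (cell_dim e)) (subtopology (realization m X) e)
          (normal_form (cell_dim e) (cell_simplex e) \<circ> disc_to_simplex (cell_dim e))"
  proof
    fix e
    assume "e \<in> cells m X"
    then obtain p s where "e = cell p s" and ps: "p \<le> m" "singular_simplex p X s"
      by (auto simp: cells_def)
    then show "continuous_map (closed_disc (cell_dim e)) (realization m X)
          (normal_form (cell_dim e) (cell_simplex e) \<circ> disc_to_simplex (cell_dim e)) \<and>
      homeomorphic_map (open_disc (cell_dim e)) (subtopology (realization m X) e)
          (normal_form (cell_dim e) (cell_simplex e) \<circ> disc_to_simplex (cell_dim e))"
      using continuous_map_compose[OF continuous_map_disc_to_simplex continuous_map_normal_form[OF ps]]
        homeomorphic_map_compose[OF homeomorphic_map_disc_to_simplex homeomorphic_map_open_cell[OF ps]]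
      by simp
  qed
  show "\<forall>e\<in>cells m X. \<exists>F\<subseteq>cells m X. finite F \<and> (\<forall>e'\<in>F. cell_dim e' < cell_dim e) \<and>
      (normal_form (cell_dim e) (cell_simplex e) \<circ> disc_to_simplex (cell_dim e)) `
        (topspace (closed_disc (cell_dim e)) - topspace (open_disc (cell_dim e))) \<subseteq> \<Union>F"
  proof
    fix e
    assume "e \<in> cells m X"
    then obtain p s where e: "e = cell p s" "p \<le> m" "singular_simplex p X s"
      by (auto simp: cells_def)
    obtain F where F: "finite F" "F \<subseteq> {cell q t | q t. q < p \<and> singular_simplex q X t}"
      "normal_form p s ` (standard_simplex p - open_simplex p) \<subseteq> \<Union>F"
      using normal_form_boundary[OF e(3)] by blast
    have "disc_to_simplex p ` (topspace (closed_disc p) - topspace (open_disc p)) \<subseteq>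
        standard_simplex p - open_simplex p"
      by (rule image_subsetI)
        (simp add: disc_to_simplex_in_standard_simplex disc_to_simplex_in_open_simplex_iff)
    then have "(normal_form p s \<circ> disc_to_simplex p) `
        (topspace (closed_disc p) - topspace (open_disc p)) \<subseteq> \<Union>F"
      unfolding image_comp[symmetric] using F(3) by (meson image_mono order_trans)
    moreover have "F \<subseteq> cells m X" "\<forall>e'\<in>F. cell_dim e' < p"
      using F(2) e(2) unfolding cells_def by force+
    ultimately show "\<exists>F\<subseteq>cells m X. finite F \<and> (\<forall>e'\<in>F. cell_dim e' < cell_dim e) \<and>
      (normal_form (cell_dim e) (cell_simplex e) \<circ> disc_to_simplex (cell_dim e)) `
        (topspace (closed_disc (cell_dim e)) - topspace (open_disc (cell_dim e))) \<subseteq> \<Union>F"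
      using F(1) e(1) by auto
  qed
  show "\<forall>A\<subseteq>topspace (realization m X).
      (\<forall>e\<in>cells m X. closedin (realization m X) (A \<inter> realization m X closure_of e)) \<longrightarrow>
      closedin (realization m X) A"
    by (intro allI impI, rule closedin_realization_weak) auto
qed

text \<open>
  A constant simplex provides a cell of the top dimension \<open>m\<close>; this is where \<open>X\<close> must have a point.
\<close>

lemma cw_complex_of_dim_realization:
  assumes "topspace X \<noteq> {}"
  shows "cw_complex_of_dim m (realization m X)"
proof -
  obtain a where "a \<in> topspace X"
    using assms by blast
  then have "singular_simplex m X (restrict (\<lambda>_. a) (standard_simplex m))"
    by (auto simp: singular_simplex_def intro: continuous_map_eq[of _ _ "\<lambda>_. a"])
  then have "\<exists>e\<in>cells m X. cell_dim e = m"
    by (force simp: cells_def)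
  moreover have "\<forall>e\<in>cells m X. cell_dim e \<le> m"
    by (auto simp: cells_def)
  ultimately show ?thesis
    using cw_decomposition_realization unfolding cw_complex_of_dim_def by blast
qed

section \<open>Tautological simplices\<close>

text \<open>
  The characteristic map of the cell of \<open>s\<close>, regarded as a singular simplex of the realization.
\<close>

definition tautological_simplex :: "nat \<Rightarrow> ((nat \<Rightarrow> real) \<Rightarrow> 'a) \<Rightarrow> (nat \<Rightarrow> real) \<Rightarrow> 'a test_point"
  where "tautological_simplex p s = restrict (normal_form p s) (standard_simplex p)"

lemma singular_simplex_tautological:
  assumes "p \<le> m" "singular_simplex p X s"
  shows "singular_simplex p (realization m X) (tautological_simplex p s)"
  using continuous_map_normal_form[OF assms]
  by (auto simp: singular_simplex_def tautological_simplex_def intro: continuous_map_eq)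

lemma simplex_map_evaluation_tautological:
  assumes "singular_simplex p X s"
  shows "simplex_map p evaluation (tautological_simplex p s) = s"
  using assms
  by (auto simp: simplex_map_def tautological_simplex_def singular_simplex_def evaluation_normal_form
      fun_eq_iff extensional_def)

lemma singular_face_tautological:
  assumes "k \<le> Suc p"
  shows "singular_face (Suc p) k (tautological_simplex (Suc p) s) =
    tautological_simplex p (singular_face (Suc p) k s)"
proof
  fix y
  show "singular_face (Suc p) k (tautological_simplex (Suc p) s) y =
    tautological_simplex p (singular_face (Suc p) k s) y"
  proof (cases "y \<in> standard_simplex p")
    case True
    then have face: "simplical_face k y \<in> standard_simplex (Suc p)"
      using assms simplical_face_in_standard_simplex[of "Suc p" k y] by simp
    moreover have "simplical_face k y k = 0"
      by (simp add: simplical_face_def)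
    ultimately have "normal_form (Suc p) s (simplical_face k y) = normal_form p (singular_face (Suc p) k s) y"
      using normal_form_singular_face[OF _ assms, of "simplical_face k y" s]
      by (simp del: normal_form.simps)
    moreover have "singular_face (Suc p) k (tautological_simplex (Suc p) s) y =
        normal_form (Suc p) s (simplical_face k y)"
      unfolding singular_face_def tautological_simplex_def
      using True face by (simp del: normal_form.simps)
    ultimately show ?thesis
      using True by (simp add: tautological_simplex_def)
  qed (simp add: singular_face_def tautological_simplex_def)
qed

text \<open>
  The last three properties say that \<open>lift\<close> is a section of \<open>\<phi>\<close> on simplices of dimension at most \<open>m\<close> that
  commutes with faces.
\<close>

lemma test_complex_exists:
  fixes X :: "'a topology" and m :: nat
  assumes "topspace X \<noteq> {}"
  obtains P :: "'a test_point topology" and \<phi>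
    and lift :: "nat \<Rightarrow> ((nat \<Rightarrow> real) \<Rightarrow> 'a) \<Rightarrow> (nat \<Rightarrow> real) \<Rightarrow> 'a test_point"
  where "cw_complex_of_dim m P" "continuous_map P X \<phi>"
    and "\<And>p s. p \<le> m \<Longrightarrow> singular_simplex p X s \<Longrightarrow> singular_simplex p P (lift p s)"
    and "\<And>p s. p \<le> m \<Longrightarrow> singular_simplex p X s \<Longrightarrow> simplex_map p \<phi> (lift p s) = s"
    and "\<And>p s k. Suc p \<le> m \<Longrightarrow> singular_simplex (Suc p) X s \<Longrightarrow> k \<le> Suc p \<Longrightarrow>
      singular_face (Suc p) k (lift (Suc p) s) = lift p (singular_face (Suc p) k s)"
proof (rule that[of "realization m X" evaluation tautological_simplex])
  show "cw_complex_of_dim m (realization m X)"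
    using assms by (rule cw_complex_of_dim_realization)
qed (simp_all add: continuous_map_evaluation singular_simplex_tautological
    simplex_map_evaluation_tautological singular_face_tautological)

section \<open>Classes of the image, locally and globally\<close>

text \<open>
  On the test complex the difference \<open>c\<close> of the two pullbacks of \<open>z\<close> has a primitive \<open>b\<close>.
  As \<open>lift\<close> is a section compatible with faces, \<open>b \<circ> lift\<close> is a primitive of \<open>c\<close> on \<open>U\<close>;
  in degree 0 it is \<open>c\<close> itself that vanishes.
\<close>

lemma pullback_difference_coboundary_on:
  fixes f g :: "'a \<Rightarrow> 'b" and z :: "((nat \<Rightarrow> real) \<Rightarrow> 'b) \<Rightarrow> 'r::comm_ring_1"
  assumes f: "continuous_map X Y f" and g: "continuous_map X Y g"
    and eq: "cohomologically_equal_on TYPE('r) m X Y f g U"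
    and z: "z \<in> cocycles p Y" and "p \<le> m"
  shows "(\<lambda>s. cochain_pullback p (subtopology X U) f z s - cochain_pullback p (subtopology X U) g z s)
    \<in> coboundaries p (subtopology X U)"
    (is "?c \<in> _")
proof (cases "topspace (subtopology X U) = {}")
  case True
  then have "?c = (\<lambda>s. 0)"
    by (auto simp: cochain_pullback_def singular_simplex_empty)
  then show ?thesis
    by (metis zero_in_coboundaries)
next
  case False
  let ?V = "subtopology X U"
  obtain P :: "'a test_point topology" and \<phi> and lift
    where P: "cw_complex_of_dim m P" and \<phi>: "continuous_map P ?V \<phi>"
      and lift: "\<And>p s. p \<le> m \<Longrightarrow> singular_simplex p ?V s \<Longrightarrow> singular_simplex p P (lift p s)"
        "\<And>p s. p \<le> m \<Longrightarrow> singular_simplex p ?V s \<Longrightarrow> simplex_map p \<phi> (lift p s) = s"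
        "\<And>p s k. Suc p \<le> m \<Longrightarrow> singular_simplex (Suc p) ?V s \<Longrightarrow> k \<le> Suc p \<Longrightarrow>
          singular_face (Suc p) k (lift (Suc p) s) = lift p (singular_face (Suc p) k s)"
    using test_complex_exists[OF False] by blast
  have fV: "continuous_map ?V Y f" and gV: "continuous_map ?V Y g"
    using f g by (auto intro: continuous_map_from_subtopology)
  let ?f = "cochain_pullback p ?V f z" and ?g = "cochain_pullback p ?V g z"
  have fz: "?f \<in> cocycles p ?V" and gz: "?g \<in> cocycles p ?V"
    using z fV gV by (auto intro: cochain_pullback_in_cocycles)
  have "(p, cohomology_class p Y z) \<in> cohomology_classes Y"
    using z by (auto simp: cohomology_classes_def cohomology_eq_classes)
  then have "pullback P \<phi> (pullback ?V f (p, cohomology_class p Y z)) =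
      pullback P \<phi> (pullback ?V g (p, cohomology_class p Y z))"
    using eq P \<phi> unfolding cohomologically_equal_on_def by blast
  then have "cohomology_class p P (cochain_pullback p P \<phi> ?f) =
      cohomology_class p P (cochain_pullback p P \<phi> ?g)"
    using z fz gz fV gV \<phi> by (simp add: pullback_cohomology_class del: pullback.simps)
  then have b: "(\<lambda>s. cochain_pullback p P \<phi> ?f s - cochain_pullback p P \<phi> ?g s) \<in> coboundaries p P"
    using \<phi> fz gz by (simp add: cohomology_class_eq_iff cochain_pullback_in_cocycles)
  have at_lift: "cochain_pullback p P \<phi> ?f (lift p s) - cochain_pullback p P \<phi> ?g (lift p s) = ?c s"
    if "singular_simplex p ?V s" for s
    using that lift(1,2) \<open>p \<le> m\<close> by (simp add: cochain_pullback_def)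
  show ?thesis
  proof (cases p)
    case 0
    then have "?c = (\<lambda>s. 0)"
      using b at_lift by (force simp: coboundaries_def cochain_pullback_def fun_eq_iff)
    then show ?thesis
      by (metis zero_in_coboundaries)
  next
    case (Suc q)
    with b obtain b where b: "(\<lambda>s. cochain_pullback p P \<phi> ?f s - cochain_pullback p P \<phi> ?g s) =
        coboundary q P b"
      by (auto simp: coboundaries_def)
    define a where "a s = (if singular_simplex q ?V s then b (lift q s) else 0)" for s
    have "?c s = coboundary q ?V a s" for s
    proof (cases "singular_simplex p ?V s")
      case True
      have "?c s = coboundary q P b (lift p s)"
        using at_lift[OF True] fun_cong[OF b, of "lift p s"] by simp
      moreover have "singular_simplex q ?V (singular_face (Suc q) k s)" if "k \<le> Suc q" for k
        using singular_simplex_singular_face[of "Suc q" ?V s k] True that Suc by simp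
      ultimately show ?thesis
        using True Suc lift(1)[of p s] lift(3)[of q s] \<open>p \<le> m\<close>
        by (simp add: coboundary_def a_def del: sum.atMost_Suc)
    qed (simp add: coboundary_def cochain_pullback_def Suc)
    then have "?c = coboundary q ?V a"
      by blast
    moreover have "a \<in> cochains q ?V"
      by (simp add: cochains_def a_def)
    ultimately show ?thesis
      by (simp add: coboundaries_def Suc)
  qed
qed

text \<open>
  A primitive of the restriction of \<open>c\<close> to \<open>U\<close>, extended by zero, is a cochain of \<open>X\<close>; subtracting its
  coboundary does not change the class.
\<close>

lemma representative_vanishing_on:
  assumes c: "c \<in> cocycles p X"
    and triv: "(\<lambda>s. if singular_simplex p (subtopology X U) s then c s else 0)
      \<in> coboundaries p (subtopology X U)"
  obtains c' where "c' \<in> cocycles p X" "cohomology_class p X c' = cohomology_class p X c"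
    "\<And>s. singular_simplex p (subtopology X U) s \<Longrightarrow> c' s = 0"
proof (cases p)
  case 0
  with triv have "c s = 0" if "singular_simplex p (subtopology X U) s" for s
    using that by (auto simp: coboundaries_def dest!: fun_cong[of _ _ s])
  then show thesis
    using c by (intro that[of c]) auto
next
  case (Suc q)
  with triv obtain b where b: "b \<in> cochains q (subtopology X U)"
    "(\<lambda>s. if singular_simplex p (subtopology X U) s then c s else 0) = coboundary q (subtopology X U) b"
    by (auto simp: coboundaries_def)
  have bX: "b \<in> cochains q X"
    using b(1) by (auto simp: cochains_def singular_simplex_subtopology)
  define c' where "c' = (\<lambda>s. c s - coboundary q X b s)"
  have db: "coboundary q X b \<in> coboundaries p X"
    using bX Suc by (simp add: coboundaries_def)
  then have "coboundary q X b \<in> cocycles p X"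
    using coboundaries_subset_cocycles by blast
  then have c': "c' \<in> cocycles p X"
    using c by (simp add: c'_def diff_in_cocycles)
  show thesis
  proof (rule that)
    show "c' \<in> cocycles p X" by fact
    show "cohomology_class p X c' = cohomology_class p X c"
      using c c' db by (intro cohomology_class_eqI) (simp add: in_cohomology_class_iff c'_def)
    show "c' s = 0" if "singular_simplex p (subtopology X U) s" for s
      using fun_cong[OF b(2), of s] that Suc
      by (simp add: c'_def coboundary_def singular_simplex_subtopology)
  qed
qed

lemma diff_image_representative:
  fixes u :: "('a, 'r::comm_ring_1) cohomology_class"
  assumes f: "continuous_map X Y f" and g: "continuous_map X Y g"
    and u: "u \<in> diff_image X Y f g" and "fst u \<le> m"
    and eq: "cohomologically_equal_on TYPE('r) m X Y f g U"
  obtains c where "c \<in> cocycles (fst u) X" "u = (fst u, cohomology_class (fst u) X c)"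
    "\<And>s. singular_simplex (fst u) (subtopology X U) s \<Longrightarrow> c s = 0"
proof -
  obtain p z where z: "z \<in> cocycles p Y"
    and u: "u = class_diff X (pullback X f (p, cohomology_class p Y z)) (pullback X g (p, cohomology_class p Y z))"
    using u by (auto simp: diff_image_def cohomology_classes_def cohomology_eq_classes simp del: pullback.simps class_diff.simps)
  define c where "c = (\<lambda>s. cochain_pullback p X f z s - cochain_pullback p X g z s)"
  have fz: "cochain_pullback p X f z \<in> cocycles p X" and gz: "cochain_pullback p X g z \<in> cocycles p X"
    using z f g by (auto intro: cochain_pullback_in_cocycles)
  then have c: "c \<in> cocycles p X"
    by (simp add: c_def diff_in_cocycles)
  have u: "u = (p, cohomology_class p X c)"
    using z f g fz gz u
    by (simp add: pullback_cohomology_class class_diff_cohomology_class c_def del: pullback.simps class_diff.simps)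
  then have "p \<le> m"
    using \<open>fst u \<le> m\<close> by simp
  have "(\<lambda>s. if singular_simplex p (subtopology X U) s then c s else 0) =
      (\<lambda>s. cochain_pullback p (subtopology X U) f z s - cochain_pullback p (subtopology X U) g z s)"
    by (auto simp: c_def cochain_pullback_def singular_simplex_subtopology)
  then have "(\<lambda>s. if singular_simplex p (subtopology X U) s then c s else 0) \<in> coboundaries p (subtopology X U)"
    using pullback_difference_coboundary_on[OF f g eq z \<open>p \<le> m\<close>] by simp
  then obtain c' where "c' \<in> cocycles p X" "cohomology_class p X c' = cohomology_class p X c"
    "\<And>s. singular_simplex p (subtopology X U) s \<Longrightarrow> c' s = 0"
    using representative_vanishing_on[OF c] by blast
  then show thesis
    using u by (intro that[of c']) auto
qed

text \<open>
  The product of representatives that are zero on \<open>U 0, \<dots>, U k\<close> respectively is zero on every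
  simplex contained in some \<open>U i\<close>, and the \<open>U i\<close> cover \<open>X\<close>.
\<close>

lemma cup_prod_eq_zero_of_cover:
  fixes X :: "'a topology" and Y :: "'b topology" and f g :: "'a \<Rightarrow> 'b"
    and u :: "nat \<Rightarrow> ('a, 'r::comm_ring_1) cohomology_class"
  assumes f: "continuous_map X Y f" and g: "continuous_map X Y g"
    and u: "\<And>i. i \<le> k \<Longrightarrow> u i \<in> diff_image X Y f g"
    and deg: "\<And>i. i \<le> k \<Longrightarrow> cohomology_degree (u i) \<le> m"
    and U: "\<And>i. i \<le> k \<Longrightarrow> openin X (U i)" "topspace X \<subseteq> (\<Union>i\<le>k. U i)"
    and eq: "\<And>i. i \<le> k \<Longrightarrow> cohomologically_equal_on TYPE('r) m X Y f g (U i)"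
  shows "cup_prod X u k = cohomology_zero (cohomology_degree (cup_prod X u k)) X"
proof -
  define p where "p i = cohomology_degree (u i)" for i
  have "\<exists>c. c \<in> cocycles (p i) X \<and> u i = (p i, cohomology_class (p i) X c) \<and>
      (\<forall>s. singular_simplex (p i) (subtopology X (U i)) s \<longrightarrow> c s = 0)" if "i \<le> k" for i
    using diff_image_representative[OF f g u deg eq, OF that that that] unfolding p_def by metis
  then obtain c where c: "\<And>i. i \<le> k \<Longrightarrow> c i \<in> cocycles (p i) X"
    "\<And>i. i \<le> k \<Longrightarrow> u i = (p i, cohomology_class (p i) X (c i))"
    "\<And>i s. i \<le> k \<Longrightarrow> singular_simplex (p i) (subtopology X (U i)) s \<Longrightarrow> c i s = 0"
    by metis
  let ?d = "\<Sum>i\<le>k. p i" and ?w = "cochain_cup_prod X p c k"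
  have w: "?w \<in> cocycles ?d X"
    using c(1) by (rule cochain_cup_prod_in_cocycles)
  have "?w \<in> coboundaries ?d X"
  proof (rule cocycle_vanishing_on_small_simplices[OF w])
    show "openin X V" if "V \<in> U ` {..k}" for V
      using that U(1) by auto
    show "topspace X \<subseteq> \<Union>(U ` {..k})"
      using U(2) .
    show "?w s = 0" if V: "V \<in> U ` {..k}" and s: "singular_simplex ?d (subtopology X V) s" for V s
    proof -
      obtain i where "i \<le> k" "V = U i"
        using V by auto
      with s show ?thesis
        by (intro cochain_cup_prod_vanishes_locally[OF c(3)]) auto
    qed
  qed
  then have "cohomology_class ?d X ?w = cohomology_class ?d X (\<lambda>s. 0)"
    using w by (simp add: cohomology_class_eq_iff)
  then show ?thesis
    using cup_prod_cohomology_class[OF c(1,2)]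
    by (simp add: cohomology_zero_def cohomology_class_def)
qed

theorem theorem4p22:
  fixes X :: "'a topology" and Y :: "'b topology" and f g :: "'a \<Rightarrow> 'b"
    and u :: "nat \<Rightarrow> ('a, 'r::comm_ring_1) cohomology_class" and k m :: nat
  assumes "continuous_map X Y f" and "continuous_map X Y g"
    and "\<And>i. i \<le> k \<Longrightarrow> u i \<in> diff_image X Y f g"
    and "cup_prod X u k \<noteq> cohomology_zero (cohomology_degree (cup_prod X u k)) X"
    and "m = Max ((\<lambda>i. cohomology_degree (u i)) ` {..k})"
  shows "cohomological_distance TYPE('r) m X Y f g \<ge> enat (k + 1)"
  unfolding cohomological_distance_def
proof (rule Inf_greatest, clarify, rule ccontr)
  fix n and U :: "nat \<Rightarrow> 'a set"
  assume U: "\<forall>i\<le>n. openin X (U i)" "(\<Union>i\<le>n. U i) = topspace X"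
    "\<forall>i\<le>n. cohomologically_equal_on TYPE('r) m X Y f g (U i)"
    and "\<not> enat (k + 1) \<le> enat n"
  then have "n \<le> k" by simp
  \<comment> \<open>There may be fewer sets than factors; the surplus factors all use the last set.\<close>
  let ?V = "\<lambda>i. U (min i n)"
  have "topspace X \<subseteq> (\<Union>i\<le>k. ?V i)"
  proof
    fix x
    assume "x \<in> topspace X"
    then obtain i where "i \<le> n" "x \<in> U i"
      using U(2) by auto
    then show "x \<in> (\<Union>i\<le>k. ?V i)"
      using \<open>n \<le> k\<close> by (intro UN_I[of i]) auto
  qed
  moreover have "cohomology_degree (u i) \<le> m" if "i \<le> k" for i
    using that assms(5) by simp
  ultimately have "cup_prod X u k = cohomology_zero (cohomology_degree (cup_prod X u k)) X"
    using U(1,3) by (intro cup_prod_eq_zero_of_cover[OF assms(1-3), where m = m and U = ?V]) auto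
  with assms(4) show False ..
qed

end
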